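(* Let $n\geq1$, $r\geq2$ be integers and $0<q<1$. The vector space $$\mathcal{A}(\mathrm{L}^{(n,r)}_q):=\bigoplus_{N\in\mathbb{Z}}\mathcal{L}_{rN}$$ is a $*$-algebra made of all elements of $\mathcal{A}(\mathrm{S}^{2n+1}_q)$ which are invariant under the action $\alpha_r:\mathbb{Z}_r\to\mathrm{Aut}(\mathcal{A}(\mathrm{S}^{2n+1}_q))$ of the cyclic group $\mathbb{Z}_r$ generated by the map $$(z_0,z_1,\dots,z_n)\mapsto(e^{2\pi\mathrm{i}/r}z_0,e^{2\pi\mathrm{i}/r}z_1,\dots,e^{2\pi\mathrm{i}/r}z_n).$$
   Context: $\mathcal{A}(\mathrm{S}^{2n+1}_q)$ is the unital complex $*$-algebra generated by $z_i,z_i^*$, $i=0,\dots,n$, with relations $z_iz_j=q^{-1}z_jz_i$ for $i<j$; $z_i^*z_j=qz_jz_i^*$ for $i\neq j$; $[z_n^*,z_n]=0$; $[z_i^*,z_i]=(1-q^2)\sum_{j=i+1}^n z_jz_j^*$ for $i=0,\dots,n-1$; $\sum_{i=0}^n z_iz_i^*=1$. $\mathcal{A}(\mathbb{C}\mathrm{P}^n_q)$ is the $*$-subalgebra generated by the elements $z_i^*z_j$. Put $[m]=\frac{q^m-q^{-m}}{q-q^{-1}}$, $[0]!=1$, $[m]!=[m]\cdots[1]$, $[j_0,\dots,j_n]!=\frac{[j_0+\dots+j_n]!}{[j_0]!\cdots[j_n]!}$. For $N\in\mathbb{Z}$, $\Psi_N$ is the column vector with $d_N=\binom{|N|+n}{n}$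 entries in $\mathcal{A}(\mathrm{S}^{2n+1}_q)$ indexed by $j_0+\dots+j_n=|N|$: $\psi^N_{j_0,\dots,j_n}=[j_0,\dots,j_n]!^{1/2}q^{-\frac12\sum_{a<b}j_aj_b}(z_0^{j_0})^*\cdots(z_n^{j_n})^*$ for $N\geq0$ and $\psi^N_{j_0,\dots,j_n}=[j_0,\dots,j_n]!^{1/2}q^{\frac12\sum_{a<b}j_aj_b+\sum_a aj_a}z_0^{j_0}\cdots z_n^{j_n}$ for $N\leq0$. One has $\Psi_N^*\Psi_N=1$. The $\mathcal{A}(\mathbb{C}\mathrm{P}^n_q)$-bimodule $\mathcal{L}_N$ is $\mathcal{L}_N:=\{v\cdot\Psi_N: v\in(\mathcal{A}(\mathbb{C}\mathrm{P}^n_q))^{d_N}\}\subset\mathcal{A}(\mathrm{S}^{2n+1}_q)$; its elements transform as $\varphi\mapsto\lambda^{-N}\varphi$ under the $\mathrm{U}(1)$-action $z_i\mapsto\lambda z_i$. The direct sum is taken inside $\mathcal{A}(\mathrm{S}^{2n+1}_q)$. *)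

theory Defs
  imports Complex_Main "HOL-Library.Poly_Mapping" "HOL-Algebra.Algebra"
    "HOL-Algebra.Algebraic_Closure_Type"
begin

section \<open>Complex *-algebras\<close>

record 'a star_algebra = "(complex, 'a) module" +
  star :: "'a \<Rightarrow> 'a"

abbreviation complex_ring :: "complex ring" where
  "complex_ring \<equiv> ring_of_type_algebra"

locale complex_star_algebra = ring A + module complex_ring A
  for A :: "('a, 'm) star_algebra_scheme" (structure) +
  assumes smult_mult_left:
      "\<lbrakk>x \<in> carrier A; y \<in> carrier A\<rbrakk> \<Longrightarrow> (c \<odot> x) \<otimes> y = c \<odot> (x \<otimes> y)"
    and smult_mult_right:
      "\<lbrakk>x \<in> carrier A; y \<in> carrier A\<rbrakk> \<Longrightarrow> x \<otimes> (c \<odot> y) = c \<odot> (x \<otimes> y)"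
    and star_closed: "x \<in> carrier A \<Longrightarrow> star A x \<in> carrier A"
    and star_star: "x \<in> carrier A \<Longrightarrow> star A (star A x) = x"
    and star_add:
      "\<lbrakk>x \<in> carrier A; y \<in> carrier A\<rbrakk> \<Longrightarrow> star A (x \<oplus> y) = star A x \<oplus> star A y"
    and star_mult:
      "\<lbrakk>x \<in> carrier A; y \<in> carrier A\<rbrakk> \<Longrightarrow> star A (x \<otimes> y) = star A y \<otimes> star A x"
    and star_smult: "x \<in> carrier A \<Longrightarrow> star A (c \<odot> x) = cnj c \<odot> star A x"

text \<open>Subalgebras are unital: they share the unit of the ambient algebra.\<close>

definition star_subalgebra :: "'a set \<Rightarrow> ('a, 'm) star_algebra_scheme \<Rightarrow> bool" where
  "star_subalgebra B A \<longleftrightarrow>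
     B \<subseteq> carrier A \<and> complex_star_algebra (A\<lparr>carrier := B\<rparr>)"

definition gen_star_subalgebra :: "('a, 'm) star_algebra_scheme \<Rightarrow> 'a set \<Rightarrow> 'a set" where
  "gen_star_subalgebra A S = \<Inter>{B. star_subalgebra B A \<and> S \<subseteq> B}"

text \<open>The group of *-automorphisms, in the style of \<^const>\<open>AutoGroup\<close>; its elements
  are extensional on the carrier.\<close>

definition star_auto :: "('a, 'm) star_algebra_scheme \<Rightarrow> ('a \<Rightarrow> 'a) set" where
  "star_auto A = {f \<in> Bij (carrier A). f \<in> ring_hom A A
      \<and> (\<forall>c. \<forall>x\<in>carrier A. f (c \<odot>\<^bsub>A\<^esub> x) = c \<odot>\<^bsub>A\<^esub> f x)
      \<and> (\<forall>x\<in>carrier A. f (star A x) = star A (f x))}"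

definition star_AutoGroup :: "('a, 'm) star_algebra_scheme \<Rightarrow> ('a \<Rightarrow> 'a) monoid" where
  "star_AutoGroup A = BijGroup (carrier A) \<lparr>carrier := star_auto A\<rparr>"

definition family_sum :: "('a, 'm) star_algebra_scheme \<Rightarrow> ('i \<Rightarrow> 'a set) \<Rightarrow> 'a set" where
  "family_sum A V = {finsum A x F | x F. finite F \<and> (\<forall>i\<in>F. x i \<in> V i)}"

definition direct_family :: "('a, 'm) star_algebra_scheme \<Rightarrow> ('i \<Rightarrow> 'a set) \<Rightarrow> bool" where
  "direct_family A V \<longleftrightarrow>
     (\<forall>i. submodule (V i) complex_ring A) \<and>
     (\<forall>F x. finite F \<longrightarrow> (\<forall>i\<in>F. x i \<in> V i) \<longrightarrow> finsum A x F = \<zero>\<^bsub>A\<^esub>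
        \<longrightarrow> (\<forall>i\<in>F. x i = \<zero>\<^bsub>A\<^esub>))"


section \<open>The free *-algebra\<close>

datatype letter = Z nat | Zstar nat

datatype word = Word (letters: "letter list")

instantiation word :: monoid_add
begin

definition "0 = Word []"
definition "u + v = Word (letters u @ letters v)"

instance
  by standard (simp_all add: zero_word_def plus_word_def)

end

text \<open>The monoid algebra of words: multiplication in \<^typ>\<open>word \<Rightarrow>\<^sub>0 complex\<close> is convolution,
  so it is bilinear concatenation of words.\<close>

type_synonym free_alg = "word \<Rightarrow>\<^sub>0 complex"

definition scale :: "complex \<Rightarrow> free_alg \<Rightarrow> free_alg" where
  "scale c p = Poly_Mapping.single 0 c * p"

fun letter_star :: "letter \<Rightarrow> letter" where
  "letter_star (Z i) = Zstar i"
| "letter_star (Zstar i) = Z i"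

definition word_star :: "word \<Rightarrow> word" where
  "word_star w = Word (rev (map letter_star (letters w)))"

definition free_star :: "free_alg \<Rightarrow> free_alg" where
  "free_star p = (\<Sum>w\<in>Poly_Mapping.keys p.
      Poly_Mapping.single (word_star w) (cnj (Poly_Mapping.lookup p w)))"

definition free_star_algebra :: "nat \<Rightarrow> free_alg star_algebra" where
  "free_star_algebra n =
    \<lparr>carrier = {p. \<forall>w\<in>Poly_Mapping.keys p. set (letters w) \<subseteq> Z ` {..n} \<union> Zstar ` {..n}},
     monoid.mult = (\<lambda>p p'. p * p'), one = 1, ring.zero = 0, add = (\<lambda>p p'. p + p'),
     module.smult = scale, star = free_star\<rparr>"

definition zf :: "nat \<Rightarrow> free_alg" where
  "zf i = Poly_Mapping.single (Word [Z i]) 1"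

definition zf_star :: "nat \<Rightarrow> free_alg" where
  "zf_star i = Poly_Mapping.single (Word [Zstar i]) 1"


section \<open>The quantum sphere and the quantum projective space\<close>

text \<open>A relation \<open>l = r\<close> is recorded as the element \<open>l - r\<close>.\<close>

definition sphere_relators :: "nat \<Rightarrow> real \<Rightarrow> free_alg set" where
  "sphere_relators n q =
     {zf i * zf j - scale (complex_of_real (inverse q)) (zf j * zf i) | i j. i < j \<and> j \<le> n}
   \<union> {zf_star i * zf j - scale (complex_of_real q) (zf j * zf_star i)
        | i j. i \<le> n \<and> j \<le> n \<and> i \<noteq> j}
   \<union> {zf_star n * zf n - zf n * zf_star n}
   \<union> {zf_star i * zf i - zf i * zf_star i
        - scale (complex_of_real (1 - q\<^sup>2)) (\<Sum>j\<in>{i<..n}. zf j * zf_star j) | i. i < n}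
   \<union> {(\<Sum>i\<le>n. zf i * zf_star i) - 1}"

text \<open>The relations are imposed in the category of *-algebras, hence the adjoint relators.\<close>

definition sphere_ideal :: "nat \<Rightarrow> real \<Rightarrow> free_alg set" where
  "sphere_ideal n q =
     Idl\<^bsub>free_star_algebra n\<^esub> (sphere_relators n q \<union> free_star ` sphere_relators n q)"

text \<open>The map induced by \<open>f\<close> on the cosets of \<open>I\<close>, in the style of \<^const>\<open>rcoset_mult\<close>; if \<open>f\<close> is
  additive and preserves \<open>I\<close>, it sends \<open>I +> x\<close> to \<open>I +> f x\<close>.\<close>

definition coset_map :: "('a, 'm) ring_scheme \<Rightarrow> 'a set \<Rightarrow> ('a \<Rightarrow> 'a) \<Rightarrow> 'a set \<Rightarrow> 'a set" where
  "coset_map R I f C = (\<Union>x\<in>C. I +>\<^bsub>R\<^esub> f x)"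

definition sphere :: "nat \<Rightarrow> real \<Rightarrow> free_alg set star_algebra" where
  "sphere n q = (let F = free_star_algebra n; I = sphere_ideal n q; Q = F Quot I in
    \<lparr>carrier = carrier Q, monoid.mult = monoid.mult Q, one = \<one>\<^bsub>Q\<^esub>, ring.zero = \<zero>\<^bsub>Q\<^esub>, add = add Q,
     module.smult = (\<lambda>c. coset_map F I (scale c)), star = coset_map F I free_star\<rparr>)"

definition z :: "nat \<Rightarrow> real \<Rightarrow> nat \<Rightarrow> free_alg set" where
  "z n q i = sphere_ideal n q +>\<^bsub>free_star_algebra n\<^esub> zf i"

definition cp :: "nat \<Rightarrow> real \<Rightarrow> free_alg set set" where
  "cp n q = gen_star_subalgebra (sphere n q)
     {star (sphere n q) (z n q i) \<otimes>\<^bsub>sphere n q\<^esub> z n q j | i j. i \<le> n \<and> j \<le> n}"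


section \<open>The line bundles\<close>

definition q_int :: "real \<Rightarrow> nat \<Rightarrow> real" where
  "q_int q m = (q ^ m - inverse q ^ m) / (q - inverse q)"

definition q_fact :: "real \<Rightarrow> nat \<Rightarrow> real" where
  "q_fact q m = (\<Prod>k=1..m. q_int q k)"

definition q_multinomial :: "nat \<Rightarrow> real \<Rightarrow> (nat \<Rightarrow> nat) \<Rightarrow> real" where
  "q_multinomial n q j = q_fact q (\<Sum>a\<le>n. j a) / (\<Prod>a\<le>n. q_fact q (j a))"

definition multi_indices :: "nat \<Rightarrow> nat \<Rightarrow> (nat \<Rightarrow> nat) set" where
  "multi_indices n m = {j \<in> {..n} \<rightarrow>\<^sub>E UNIV. (\<Sum>a\<le>n. j a) = m}"

text \<open>The ordered product \<open>f 0 \<cdots> f n\<close> in a noncommutative algebra.\<close>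

definition ordered_prod :: "('a, 'm) monoid_scheme \<Rightarrow> nat \<Rightarrow> (nat \<Rightarrow> 'a) \<Rightarrow> 'a" where
  "ordered_prod A n f = foldr (monoid.mult A) (map f [0..<Suc n]) \<one>\<^bsub>A\<^esub>"

text \<open>For \<open>N = 0\<close> the only multi-index is zero and both formulas give \<open>1\<close>.\<close>

definition psi :: "nat \<Rightarrow> real \<Rightarrow> int \<Rightarrow> (nat \<Rightarrow> nat) \<Rightarrow> free_alg set" where
  "psi n q N j = (let A = sphere n q; s = (\<Sum>b\<le>n. \<Sum>a<b. real (j a * j b)) in
     if N \<ge> 0 then
       complex_of_real (sqrt (q_multinomial n q j) * q powr (- s / 2))
         \<odot>\<^bsub>A\<^esub> ordered_prod A n (\<lambda>a. star A (z n q a [^]\<^bsub>A\<^esub> j a))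
     else
       complex_of_real (sqrt (q_multinomial n q j) * q powr (s / 2 + (\<Sum>a\<le>n. real (a * j a))))
         \<odot>\<^bsub>A\<^esub> ordered_prod A n (\<lambda>a. z n q a [^]\<^bsub>A\<^esub> j a))"

definition line_bundle :: "nat \<Rightarrow> real \<Rightarrow> int \<Rightarrow> free_alg set set" where
  "line_bundle n q N = (let A = sphere n q; J = multi_indices n (nat \<bar>N\<bar>) in
     {finsum A (\<lambda>j. v j \<otimes>\<^bsub>A\<^esub> psi n q N j) J | v. \<forall>j\<in>J. v j \<in> cp n q})"

definition lens :: "nat \<Rightarrow> nat \<Rightarrow> real \<Rightarrow> free_alg set set" where
  "lens n r q = family_sum (sphere n q) (\<lambda>N::int. line_bundle n q (int r * N))"


section \<open>The cyclic group action\<close>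

text \<open>The substitution \<open>z\<^sub>i \<mapsto> t z\<^sub>i\<close>, \<open>z\<^sub>i\<^sup>* \<mapsto> t\<^sup>-\<^sup>1 z\<^sub>i\<^sup>*\<close> on the free algebra, for a complex
  number \<open>t\<close> of modulus 1, multiplies a word by \<open>t\<close> to the number of letters \<open>z\<^sub>i\<close> minus the
  number of letters \<open>z\<^sub>i\<^sup>*\<close>.\<close>

definition charge :: "word \<Rightarrow> int" where
  "charge w = (\<Sum>l\<leftarrow>letters w. case l of Z _ \<Rightarrow> 1 | Zstar _ \<Rightarrow> -1)"

definition rotate_free :: "complex \<Rightarrow> free_alg \<Rightarrow> free_alg" where
  "rotate_free t p = (\<Sum>w\<in>Poly_Mapping.keys p.
      Poly_Mapping.single w (t powi charge w * Poly_Mapping.lookup p w))"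

definition cyclic_action :: "nat \<Rightarrow> nat \<Rightarrow> real \<Rightarrow> int \<Rightarrow> free_alg set \<Rightarrow> free_alg set" where
  "cyclic_action n r q k = (\<lambda>C\<in>carrier (sphere n q).
     coset_map (free_star_algebra n) (sphere_ideal n q)
       (rotate_free (exp (2 * of_real pi * \<i> * of_int k / of_nat r))) C)"

end

(*
  A multiplier acting on words through their charge preserves the ideal of relations, because the
  relators are homogeneous; hence the sphere is graded by Z, and all rotations and projections onto
  graded parts descend to it. The bundle L_N is the part of charge -N:
  - The relations let one exchange a letter z and a letter z* at the price of a linear combination
    of such exchanges, so every word of charge 0 can be rearranged into products of the z_i^* z_j.
  - Inserting 1 = sum z_i z_i^* (or 1 as a combination of the z_i^* z_j) repeatedly to the right of an
    element of charge -N splits off |N| letters z* (or z), whose product is a scalar multiple of an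
    entry of Psi_N; this replaces the exact identity Psi_N^* Psi_N = 1.
  Directness of the sum and the description of the fixed points are then statements on the grading.
*)

theory Submission
  imports Defs
begin

section \<open>The free *-algebra\<close>

text \<open>All computations run on representatives in the free algebra, equality in the sphere
  being membership of the difference in \<open>sphere_ideal n q\<close>. The obstacle is that
  exchanging \<open>zf_star i\<close> with \<open>zf i\<close> is not a rewriting rule with one
  term: the commutator brings in every \<open>zf k * zf_star k\<close> with \<open>k > i\<close>, so
  coefficients cannot be followed through a long reordering. "Can be rewritten as" is therefore
  expressed by membership in a linear subspace that contains the ideal (\<open>lin_closed\<close>),
  and only the pattern of signs in a word is controlled. Among letters of one kind an exchange costs
  just a scalar, so there single monomials can be tracked (\<open>qcomm\<close>).

  Multipliers are taken for arbitrary functions of the charge. The characters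
  \<open>\<lambda>d. t powi d\<close> give automorphisms, but the projections and the division by
  \<open>\<zeta>^d - 1\<close> are not multiplicative. What remains true for all of them is that
  multiplication by a word shifts the function, and this is enough to preserve the ideal.\<close>

lemma poly_mapping_sum_single:
  fixes p :: "'a \<Rightarrow>\<^sub>0 'b::comm_monoid_add"
  shows "p = (\<Sum>w\<in>Poly_Mapping.keys p. Poly_Mapping.single w (Poly_Mapping.lookup p w))"
proof (rule poly_mapping_eqI)
  fix k
  have "(\<Sum>w\<in>Poly_Mapping.keys p. Poly_Mapping.lookup p w when w = k) = Poly_Mapping.lookup p k"
    by (simp add: when_def sum.delta' in_keys_iff)
  then show "Poly_Mapping.lookup p k = Poly_Mapping.lookup
      (\<Sum>w\<in>Poly_Mapping.keys p. Poly_Mapping.single w (Poly_Mapping.lookup p w)) k"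
    by (simp add: lookup_sum lookup_single)
qed

text \<open>The case \<open>single\<close> concerns only words in the support of \<open>p\<close>,
  so facts about the support (letters of index at most \<open>n\<close>, charge zero) can be used
  there; the coefficient is left arbitrary.\<close>

lemma poly_mapping_single_induct [case_names zero add single]:
  fixes p :: "'a \<Rightarrow>\<^sub>0 'b::comm_monoid_add"
  assumes "P 0" and "\<And>a b. P a \<Longrightarrow> P b \<Longrightarrow> P (a + b)"
    and single: "\<And>w c. w \<in> Poly_Mapping.keys p \<Longrightarrow> P (Poly_Mapping.single w c)"
  shows "P p"
proof -
  have "P (\<Sum>w\<in>K. Poly_Mapping.single w (Poly_Mapping.lookup p w))"
    if "finite K" "K \<subseteq> Poly_Mapping.keys p" for K
    using that by (induction K) (use assms in auto)
  from this[of "Poly_Mapping.keys p"] show ?thesis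
    using poly_mapping_sum_single[of p] by simp
qed

lemma lookup_scale: "Poly_Mapping.lookup (scale c p) w = c * Poly_Mapping.lookup p w"
proof (induction p rule: poly_mapping_single_induct)
  case zero
  show ?case by (simp add: scale_def)
next
  case (add a b)
  then show ?case by (simp add: scale_def distrib_left lookup_add)
next
  case (single u d)
  show ?case by (simp add: scale_def mult_single lookup_single when_def)
qed

lemma scale_add_right: "scale c (p + p') = scale c p + scale c p'"
  by (simp add: scale_def distrib_left)

lemma scale_diff_right: "scale c (p - p') = scale c p - scale c p'"
  by (simp add: scale_def right_diff_distrib)

lemma scale_add_left: "scale (c + d) p = scale c p + scale d p"
  by (simp add: scale_def distrib_right single_add)

lemma scale_scale [simp]: "scale c (scale d p) = scale (c * d) p"
  by (simp add: scale_def mult_single flip: mult.assoc)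

lemma scale_one [simp]: "scale 1 p = p"
  by (simp add: scale_def)

lemma scale_zero_left [simp]: "scale 0 p = 0"
  by (simp add: scale_def)

lemma scale_zero_right [simp]: "scale c 0 = 0"
  by (simp add: scale_def)

lemma scale_minus_one: "scale (- 1) p = - p"
  by (rule poly_mapping_eqI) (simp add: lookup_scale)

lemma scale_mult_left: "scale c p * p' = scale c (p * p')"
  by (simp add: scale_def mult.assoc)

text \<open>Constants sit on the empty word, which is neutral for concatenation, hence they are
  central.\<close>

lemma scale_mult_right: "p * scale c p' = scale c (p * p')"
proof -
  have "p * Poly_Mapping.single 0 c = Poly_Mapping.single 0 c * p"
    by (induction p rule: poly_mapping_single_induct)
      (simp_all add: distrib_left distrib_right mult_single mult.commute)
  then show ?thesis
    by (simp add: scale_def flip: mult.assoc)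
qed

lemma scale_sum: "scale c (\<Sum>i\<in>S. f i) = (\<Sum>i\<in>S. scale c (f i))"
  by (simp add: scale_def sum_distrib_left)

lemma single_eq_scale: "Poly_Mapping.single w c = scale c (Poly_Mapping.single w 1)"
  by (simp add: scale_def mult_single)

lemma letter_star_letter_star [simp]: "letter_star (letter_star l) = l"
  by (cases l) auto

lemma word_star_word_star [simp]: "word_star (word_star w) = w"
  by (simp add: word_star_def rev_map o_def)

lemma word_star_eq_iff: "word_star u = w \<longleftrightarrow> u = word_star w"
  by auto

lemma word_star_add: "word_star (u + w) = word_star w + word_star u"
  by (simp add: word_star_def plus_word_def)

lemma lookup_free_star:
  "Poly_Mapping.lookup (free_star p) w = cnj (Poly_Mapping.lookup p (word_star w))"
proof -
  have "(\<Sum>u\<in>Poly_Mapping.keys p. cnj (Poly_Mapping.lookup p u) when u = word_star w) =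
      cnj (Poly_Mapping.lookup p (word_star w))"
    by (simp add: when_def sum.delta' in_keys_iff)
  then show ?thesis
    by (simp add: free_star_def lookup_sum lookup_single word_star_eq_iff)
qed

lemma free_star_free_star [simp]: "free_star (free_star p) = p"
  by (rule poly_mapping_eqI) (simp add: lookup_free_star)

lemma free_star_zero [simp]: "free_star 0 = 0"
  by (simp add: free_star_def)

lemma free_star_add: "free_star (p + p') = free_star p + free_star p'"
  by (rule poly_mapping_eqI) (simp add: lookup_free_star lookup_add)

lemma free_star_diff: "free_star (p - p') = free_star p - free_star p'"
  by (rule poly_mapping_eqI) (simp add: lookup_free_star lookup_minus)

lemma free_star_scale: "free_star (scale c p) = scale (cnj c) (free_star p)"
  by (rule poly_mapping_eqI) (simp add: lookup_free_star lookup_scale)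

lemma free_star_single: "free_star (Poly_Mapping.single w c) = Poly_Mapping.single (word_star w) (cnj c)"
  by (rule poly_mapping_eqI)
    (auto simp: lookup_free_star lookup_single when_def)

lemma free_star_mult: "free_star (p * p') = free_star p' * free_star p"
proof (induction p rule: poly_mapping_single_induct)
  case (single w c)
  show ?case
    by (induction p' rule: poly_mapping_single_induct)
      (simp_all add: distrib_left distrib_right free_star_add free_star_single mult_single
        word_star_add mult.commute)
qed (simp_all add: distrib_left distrib_right free_star_add)

lemma free_star_zf [simp]: "free_star (zf i) = zf_star i"
  by (simp add: zf_def zf_star_def free_star_single word_star_def)

lemma free_star_zf_star [simp]: "free_star (zf_star i) = zf i"
  by (simp add: zf_def zf_star_def free_star_single word_star_def)

lemma free_star_one [simp]: "free_star 1 = 1"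
proof -
  have "word_star 0 = 0" by (simp add: word_star_def zero_word_def)
  then show ?thesis
    using free_star_single[of 0 1] by simp
qed

lemma free_star_power: "free_star (p ^ k) = free_star p ^ k"
  by (induction k) (simp_all add: free_star_mult power_commutes)

section \<open>The charge grading of the free algebra\<close>

lemma charge_add: "charge (u + w) = charge u + charge w"
  by (simp add: charge_def plus_word_def)

lemma charge_word_star: "charge (word_star w) = - charge w"
proof -
  have "charge (Word (rev (map letter_star ls))) = - charge (Word ls)" for ls
  proof (induction ls)
    case (Cons l ls)
    then show ?case by (cases l) (simp_all add: charge_def)
  qed (simp add: charge_def)
  from this[of "letters w"] show ?thesis
    by (simp add: word_star_def)
qed

text \<open>One family for three kinds of operators: powers of \<open>t\<close> give rotations,
  indicators give projections onto charges, and inverses of \<open>t powi d - 1\<close> undo the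
  difference of a rotation and the identity.\<close>

definition charge_mult :: "(int \<Rightarrow> complex) \<Rightarrow> free_alg \<Rightarrow> free_alg" where
  "charge_mult g p = (\<Sum>w\<in>Poly_Mapping.keys p.
      Poly_Mapping.single w (g (charge w) * Poly_Mapping.lookup p w))"

lemma rotate_free_eq: "rotate_free t = charge_mult (\<lambda>d. t powi d)"
  by (simp add: fun_eq_iff rotate_free_def charge_mult_def)

lemma lookup_charge_mult:
  "Poly_Mapping.lookup (charge_mult g p) w = g (charge w) * Poly_Mapping.lookup p w"
proof -
  have "(\<Sum>u\<in>Poly_Mapping.keys p. g (charge u) * Poly_Mapping.lookup p u when u = w) =
      g (charge w) * Poly_Mapping.lookup p w"
    by (simp add: when_def sum.delta' in_keys_iff)
  then show ?thesis
    by (simp add: charge_mult_def lookup_sum lookup_single)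
qed

lemma charge_mult_zero [simp]: "charge_mult g 0 = 0"
  by (simp add: charge_mult_def)

lemma charge_mult_add: "charge_mult g (p + p') = charge_mult g p + charge_mult g p'"
  by (rule poly_mapping_eqI) (simp add: lookup_charge_mult lookup_add distrib_left)

lemma charge_mult_diff: "charge_mult g (p - p') = charge_mult g p - charge_mult g p'"
  by (rule poly_mapping_eqI) (simp add: lookup_charge_mult lookup_minus right_diff_distrib)

lemma charge_mult_sum: "charge_mult g (\<Sum>i\<in>S. f i) = (\<Sum>i\<in>S. charge_mult g (f i))"
  by (rule poly_mapping_eqI) (simp add: lookup_charge_mult lookup_sum sum_distrib_left)

lemma charge_mult_scale: "charge_mult g (scale c p) = scale c (charge_mult g p)"
  by (rule poly_mapping_eqI) (simp add: lookup_charge_mult lookup_scale)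

lemma charge_mult_charge_mult: "charge_mult g (charge_mult h p) = charge_mult (\<lambda>d. g d * h d) p"
  by (rule poly_mapping_eqI) (simp add: lookup_charge_mult)

lemma charge_mult_single:
  "charge_mult g (Poly_Mapping.single w c) = Poly_Mapping.single w (g (charge w) * c)"
  by (rule poly_mapping_eqI) (auto simp: lookup_charge_mult lookup_single when_def)

text \<open>A word passes through the multiplier by shifting \<open>g\<close>. This holds for every
  \<open>g\<close> and replaces the multiplicativity that only characters have.\<close>

lemma charge_mult_single_mult:
  "charge_mult g (Poly_Mapping.single w c * p) =
    Poly_Mapping.single w c * charge_mult (\<lambda>d. g (charge w + d)) p"
  by (induction p rule: poly_mapping_single_induct)
    (simp_all add: distrib_left charge_mult_add mult_single charge_mult_single charge_add
      mult_ac)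

lemma charge_mult_mult_single:
  "charge_mult g (p * Poly_Mapping.single w c) =
    charge_mult (\<lambda>d. g (d + charge w)) p * Poly_Mapping.single w c"
  by (induction p rule: poly_mapping_single_induct)
    (simp_all add: distrib_right charge_mult_add mult_single charge_mult_single charge_add
      mult_ac)

lemma charge_mult_mult:
  assumes "\<And>d e. g (d + e) = g d * g e"
  shows "charge_mult g (p * p') = charge_mult g p * charge_mult g p'"
proof (induction p rule: poly_mapping_single_induct)
  case (single w c)
  show ?case
    by (induction p' rule: poly_mapping_single_induct)
      (simp_all add: distrib_left distrib_right charge_mult_add mult_single charge_mult_single
        charge_add assms mult_ac)
qed (simp_all add: distrib_left distrib_right charge_mult_add)

lemma charge_mult_free_star:
  "charge_mult g (free_star p) = free_star (charge_mult (\<lambda>d. cnj (g (- d))) p)"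
  by (rule poly_mapping_eqI) (simp add: lookup_charge_mult lookup_free_star charge_word_star)

definition homog :: "int \<Rightarrow> free_alg \<Rightarrow> bool" where
  "homog d p \<longleftrightarrow> (\<forall>w\<in>Poly_Mapping.keys p. charge w = d)"

lemma homog_charge_mult:
  assumes "homog d p"
  shows "charge_mult g p = scale (g d) p"
  using assms
  by (intro poly_mapping_eqI) (auto simp: lookup_charge_mult lookup_scale homog_def in_keys_iff)

lemma homog_indicator: "homog d (charge_mult (\<lambda>e. if e = d then 1 else 0) p)"
  by (auto simp: homog_def in_keys_iff lookup_charge_mult split: if_splits)

text \<open>Being homogeneous becomes a fixed-point equation of a linear map, so closure under
  linear operations follows from linearity of \<open>charge_mult\<close>.\<close>

lemma homog_iff: "homog d p \<longleftrightarrow> charge_mult (\<lambda>e. if e = d then 1 else 0) p = p"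
  using homog_charge_mult[of d p "\<lambda>e. if e = d then 1 else 0"] homog_indicator[of d p] by auto

lemma homog_zero [simp]: "homog d 0"
  by (simp add: homog_def)

lemma homog_add: "homog d p \<Longrightarrow> homog d p' \<Longrightarrow> homog d (p + p')"
  by (simp add: homog_iff charge_mult_add)

lemma homog_diff: "homog d p \<Longrightarrow> homog d p' \<Longrightarrow> homog d (p - p')"
  by (simp add: homog_iff charge_mult_diff)

lemma homog_scale: "homog d p \<Longrightarrow> homog d (scale c p)"
  by (simp add: homog_iff charge_mult_scale)

lemma homog_sum: "(\<And>i. i \<in> S \<Longrightarrow> homog d (f i)) \<Longrightarrow> homog d (\<Sum>i\<in>S. f i)"
  by (induction S rule: infinite_finite_induct) (auto intro: homog_add)

lemma homog_single: "homog (charge w) (Poly_Mapping.single w c)"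
  by (simp add: homog_def)

lemma homog_one [simp]: "homog 0 1"
proof -
  have "charge 0 = 0"
    by (simp add: charge_def zero_word_def)
  then show ?thesis
    using homog_single[of 0 1] by simp
qed

lemma homog_mult:
  assumes "homog d p" "homog e p'"
  shows "homog (d + e) (p * p')"
  unfolding homog_def
proof
  fix w assume "w \<in> Poly_Mapping.keys (p * p')"
  then obtain u v where "w = u + v" "u \<in> Poly_Mapping.keys p" "v \<in> Poly_Mapping.keys p'"
    using keys_mult[of p p'] by blast
  then show "charge w = d + e"
    using assms by (simp add: homog_def charge_add)
qed

lemma homog_free_star:
  assumes "homog d p"
  shows "homog (- d) (free_star p)"
  unfolding homog_def
proof
  fix w assume "w \<in> Poly_Mapping.keys (free_star p)"
  then have "charge (word_star w) = d"
    using assms by (simp add: homog_def in_keys_iff lookup_free_star)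
  then show "charge w = - d"
    by (simp add: charge_word_star)
qed

lemma homog_zf [simp]: "homog 1 (zf i)"
  using homog_single[of "Word [Z i]" 1] by (simp add: zf_def charge_def)

lemma homog_zf_star [simp]: "homog (- 1) (zf_star i)"
  using homog_single[of "Word [Zstar i]" 1] by (simp add: zf_star_def charge_def)

lemma homog_power: "homog d p \<Longrightarrow> homog (int k * d) (p ^ k)"
proof (induction k)
  case (Suc k)
  then show ?case using homog_mult[of d p "int k * d" "p ^ k"] by (simp add: algebra_simps)
qed simp

lemma homog_prod_list:
  "(\<And>a. a \<in> set as \<Longrightarrow> homog (d a) (f a)) \<Longrightarrow> homog (\<Sum>a\<leftarrow>as. d a) (\<Prod>a\<leftarrow>as. f a)"
  by (induction as) (auto intro: homog_mult)

section \<open>The free algebra on the letters of index at most n\<close>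

definition free_carrier :: "nat \<Rightarrow> free_alg set" where
  "free_carrier n = {p. \<forall>w\<in>Poly_Mapping.keys p. set (letters w) \<subseteq> Z ` {..n} \<union> Zstar ` {..n}}"

lemma free_star_algebra_simps [simp]:
  "carrier (free_star_algebra n) = free_carrier n"
  "monoid.mult (free_star_algebra n) = (\<lambda>p p'. p * p')"
  "\<one>\<^bsub>free_star_algebra n\<^esub> = 1" "\<zero>\<^bsub>free_star_algebra n\<^esub> = 0"
  "add (free_star_algebra n) = (\<lambda>p p'. p + p')"
  "module.smult (free_star_algebra n) = scale"
  "star (free_star_algebra n) = free_star"
  by (simp_all add: free_star_algebra_def free_carrier_def)

lemma free_carrier_zero [simp, intro]: "0 \<in> free_carrier n"
  by (simp add: free_carrier_def)

lemma free_carrier_single: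
  "set (letters w) \<subseteq> Z ` {..n} \<union> Zstar ` {..n} \<Longrightarrow> Poly_Mapping.single w c \<in> free_carrier n"
  by (simp add: free_carrier_def)

lemma free_carrier_one [simp, intro]: "1 \<in> free_carrier n"
proof -
  have "letters 0 = []"
    by (simp add: zero_word_def)
  then show ?thesis
    using free_carrier_single[of 0 n 1] by simp
qed

lemma free_carrier_add [intro]:
  "p \<in> free_carrier n \<Longrightarrow> p' \<in> free_carrier n \<Longrightarrow> p + p' \<in> free_carrier n"
  using keys_add[of p p'] by (auto simp: free_carrier_def)

lemma free_carrier_mult [intro]:
  assumes "p \<in> free_carrier n" "p' \<in> free_carrier n"
  shows "p * p' \<in> free_carrier n"
  unfolding free_carrier_def mem_Collect_eq
proof
  fix w assume "w \<in> Poly_Mapping.keys (p * p')"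
  then obtain u v where "w = u + v" "u \<in> Poly_Mapping.keys p" "v \<in> Poly_Mapping.keys p'"
    using keys_mult[of p p'] by blast
  then show "set (letters w) \<subseteq> Z ` {..n} \<union> Zstar ` {..n}"
    using assms by (auto simp: free_carrier_def plus_word_def)
qed

lemma free_carrier_scale [intro]: "p \<in> free_carrier n \<Longrightarrow> scale c p \<in> free_carrier n"
  by (auto simp: free_carrier_def in_keys_iff lookup_scale)

lemma free_carrier_uminus [intro]: "p \<in> free_carrier n \<Longrightarrow> - p \<in> free_carrier n"
  using free_carrier_scale[of p n "- 1"] by (simp add: scale_minus_one)

lemma free_carrier_diff [intro]:
  "p \<in> free_carrier n \<Longrightarrow> p' \<in> free_carrier n \<Longrightarrow> p - p' \<in> free_carrier n"
  using free_carrier_add[of p n "- p'"] by auto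

lemma free_carrier_sum [intro]:
  "(\<And>i. i \<in> S \<Longrightarrow> f i \<in> free_carrier n) \<Longrightarrow> (\<Sum>i\<in>S. f i) \<in> free_carrier n"
  by (induction S rule: infinite_finite_induct) auto

lemma free_carrier_power [intro]: "p \<in> free_carrier n \<Longrightarrow> p ^ k \<in> free_carrier n"
  by (induction k) auto

lemma free_carrier_prod_list [intro]:
  "(\<And>a. a \<in> set as \<Longrightarrow> f a \<in> free_carrier n) \<Longrightarrow> (\<Prod>a\<leftarrow>as. f a) \<in> free_carrier n"
  by (induction as) auto

lemma free_carrier_charge_mult [intro]: "p \<in> free_carrier n \<Longrightarrow> charge_mult g p \<in> free_carrier n"
  by (auto simp: free_carrier_def in_keys_iff lookup_charge_mult)

lemma free_carrier_star [intro]: 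
  assumes "p \<in> free_carrier n"
  shows "free_star p \<in> free_carrier n"
  unfolding free_carrier_def mem_Collect_eq
proof
  fix w assume "w \<in> Poly_Mapping.keys (free_star p)"
  then have "set (letters (word_star w)) \<subseteq> Z ` {..n} \<union> Zstar ` {..n}"
    using assms by (simp add: free_carrier_def in_keys_iff lookup_free_star)
  then have "letter_star l \<in> Z ` {..n} \<union> Zstar ` {..n}" if "l \<in> set (letters w)" for l
    using that by (auto simp: word_star_def)
  moreover have "l \<in> Z ` {..n} \<union> Zstar ` {..n}"
    if "letter_star l \<in> Z ` {..n} \<union> Zstar ` {..n}" for l
    using that by (cases l) auto
  ultimately show "set (letters w) \<subseteq> Z ` {..n} \<union> Zstar ` {..n}"
    by blast
qed

lemma free_carrier_zf [intro]: "i \<le> n \<Longrightarrow> zf i \<in> free_carrier n"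
  unfolding zf_def by (rule free_carrier_single) auto

lemma free_carrier_zf_star [intro]: "i \<le> n \<Longrightarrow> zf_star i \<in> free_carrier n"
  unfolding zf_star_def by (rule free_carrier_single) auto

lemma ring_free_star_algebra: "ring (free_star_algebra n)"
proof (rule ringI)
  show "abelian_group (free_star_algebra n)"
    by (rule abelian_groupI) (auto simp: add_ac intro!: bexI[where x = "- _"])
  show "Group.monoid (free_star_algebra n)"
    by (rule monoidI) (auto simp: mult.assoc)
qed (auto simp: distrib_left distrib_right)

lemma a_inv_free_star_algebra:
  assumes "p \<in> free_carrier n"
  shows "\<ominus>\<^bsub>free_star_algebra n\<^esub> p = - p"
proof -
  interpret ring "free_star_algebra n" by (rule ring_free_star_algebra)
  show ?thesis
    using assms by (intro minus_equality) auto
qed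

section \<open>*-subalgebras\<close>

text \<open>Zero and negatives come from the scalars, as \<open>0 \<odot> \<one>\<close> and
  \<open>(- 1) \<odot> x\<close>. The algebraic laws are inherited from the ambient algebra.\<close>

lemma star_subalgebraI:
  assumes "complex_star_algebra A" and "B \<subseteq> carrier A" and one: "\<one>\<^bsub>A\<^esub> \<in> B"
    and add: "\<And>x y. x \<in> B \<Longrightarrow> y \<in> B \<Longrightarrow> x \<oplus>\<^bsub>A\<^esub> y \<in> B"
    and mult: "\<And>x y. x \<in> B \<Longrightarrow> y \<in> B \<Longrightarrow> x \<otimes>\<^bsub>A\<^esub> y \<in> B"
    and smult: "\<And>c x. x \<in> B \<Longrightarrow> c \<odot>\<^bsub>A\<^esub> x \<in> B"
    and star: "\<And>x. x \<in> B \<Longrightarrow> star A x \<in> B"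
  shows "star_subalgebra B A"
proof -
  interpret complex_star_algebra A by fact
  note ringA = complex_star_algebra.axioms(1)[OF assms(1)]
  note abA = ringE(1)[OF ringA] and monA = ringE(2)[OF ringA]
  have carr: "x \<in> carrier A" if "x \<in> B" for x
    using that assms(2) by auto
  have cc: "c \<in> carrier complex_ring" for c
    by (simp add: ring_of_type_algebra_def)
  have ops: "\<one>\<^bsub>complex_ring\<^esub> = (1 :: complex)" "\<zero>\<^bsub>complex_ring\<^esub> = (0 :: complex)"
      "x \<oplus>\<^bsub>complex_ring\<^esub> y = x + y" "x \<otimes>\<^bsub>complex_ring\<^esub> y = x * y" for x y :: complex
    by (simp_all add: ring_of_type_algebra_def)
  have neg: "(- 1) \<odot>\<^bsub>A\<^esub> x \<oplus>\<^bsub>A\<^esub> x = \<zero>\<^bsub>A\<^esub>" if "x \<in> B" for x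
  proof -
    have "(- 1) \<odot>\<^bsub>A\<^esub> x \<oplus>\<^bsub>A\<^esub> 1 \<odot>\<^bsub>A\<^esub> x = 0 \<odot>\<^bsub>A\<^esub> x"
      using smult_l_distr[OF cc cc carr[OF that], of "- 1" 1] by (simp add: ops)
    then show ?thesis
      using smult_one[OF carr[OF that]] smult_l_null[OF carr[OF that]] by (simp add: ops)
  qed
  have zero: "\<zero>\<^bsub>A\<^esub> \<in> B"
    using smult_l_null[OF carr[OF one]] smult[OF one, of 0] by (simp add: ops)
  let ?B = "A\<lparr>carrier := B\<rparr>"
  have ab: "abelian_group ?B"
  proof (rule abelian_groupI)
    fix x assume "x \<in> carrier ?B"
    then show "\<exists>y\<in>carrier ?B. y \<oplus>\<^bsub>?B\<^esub> x = \<zero>\<^bsub>?B\<^esub>"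
      using neg smult by auto
  qed (auto simp: zero add carr abelian_groupE(3)[OF abA] intro: abelian_groupE(4)[OF abA])
  have "complex_star_algebra ?B"
  proof (intro complex_star_algebra.intro complex_star_algebra_axioms.intro)
    show "ring ?B"
    proof (rule ringI[OF ab])
      show "Group.monoid ?B"
        by (rule monoidI) (simp_all add: one mult carr monoid.m_assoc[OF monA] monoid.l_one[OF monA]
            monoid.r_one[OF monA])
    qed (simp_all add: carr ringE(3,4)[OF ringA])
    show "module complex_ring ?B"
      by (rule moduleI[OF cring_from_type_algebra ab])
        (simp_all add: smult carr cc smult_l_distr smult_r_distr smult_assoc1)
  qed (simp_all add: carr star smult_mult_left smult_mult_right star_star star_add star_mult
      star_smult)
  then show ?thesis
    using assms(2) by (simp add: star_subalgebra_def)
qed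

lemma star_subalgebraD:
  assumes "star_subalgebra B A"
  shows "B \<subseteq> carrier A" "\<one>\<^bsub>A\<^esub> \<in> B"
    and "x \<in> B \<Longrightarrow> y \<in> B \<Longrightarrow> x \<oplus>\<^bsub>A\<^esub> y \<in> B"
    and "x \<in> B \<Longrightarrow> y \<in> B \<Longrightarrow> x \<otimes>\<^bsub>A\<^esub> y \<in> B"
    and "x \<in> B \<Longrightarrow> c \<odot>\<^bsub>A\<^esub> x \<in> B"
    and "x \<in> B \<Longrightarrow> star A x \<in> B"
proof -
  have B: "complex_star_algebra (A\<lparr>carrier := B\<rparr>)"
    using assms by (simp add: star_subalgebra_def)
  note ringB = complex_star_algebra.axioms(1)[OF B]
  show "B \<subseteq> carrier A"
    using assms by (simp add: star_subalgebra_def)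
  show "\<one>\<^bsub>A\<^esub> \<in> B" "x \<in> B \<Longrightarrow> y \<in> B \<Longrightarrow> x \<oplus>\<^bsub>A\<^esub> y \<in> B"
    "x \<in> B \<Longrightarrow> y \<in> B \<Longrightarrow> x \<otimes>\<^bsub>A\<^esub> y \<in> B" "x \<in> B \<Longrightarrow> star A x \<in> B"
    using monoid.one_closed[OF ringE(2)[OF ringB]] monoid.m_closed[OF ringE(2)[OF ringB], of x y]
      abelian_groupE(1)[OF ringE(1)[OF ringB], of x y] complex_star_algebra.star_closed[OF B, of x]
    by simp_all
  show "x \<in> B \<Longrightarrow> c \<odot>\<^bsub>A\<^esub> x \<in> B"
    using module.smult_closed[OF complex_star_algebra.axioms(2)[OF B], of c x] by (simp add: ring_of_type_algebra_def)
qed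

section \<open>The quantum sphere\<close>

locale quantum_sphere =
  fixes n :: nat and q :: real
  assumes q_pos: "0 < q" and q_less_one: "q < 1"
begin

abbreviation (input) Fc :: "free_alg set" where "Fc \<equiv> free_carrier n"

abbreviation (input) I :: "free_alg set" where "I \<equiv> sphere_ideal n q"

abbreviation (input) A :: "free_alg set star_algebra" where "A \<equiv> sphere n q"

lemma sphere_relators_cases [consumes 1, case_names zz sz nn ii sum]:
  assumes "x \<in> sphere_relators n q"
  obtains i j where "i < j" "j \<le> n"
      "x = zf i * zf j - scale (complex_of_real (inverse q)) (zf j * zf i)"
  | i j where "i \<le> n" "j \<le> n" "i \<noteq> j"
      "x = zf_star i * zf j - scale (complex_of_real q) (zf j * zf_star i)"
  | "x = zf_star n * zf n - zf n * zf_star n"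
  | i where "i < n" "x = zf_star i * zf i - zf i * zf_star i
        - scale (complex_of_real (1 - q\<^sup>2)) (\<Sum>j\<in>{i<..n}. zf j * zf_star j)"
  | "x = (\<Sum>i\<le>n. zf i * zf_star i) - 1"
  using assms unfolding sphere_relators_def by blast

lemma sphere_relators_carrier: "sphere_relators n q \<subseteq> Fc"
proof
  fix x assume "x \<in> sphere_relators n q"
  then show "x \<in> Fc"
    by (cases rule: sphere_relators_cases)
      (auto intro!: free_carrier_diff free_carrier_scale free_carrier_mult free_carrier_sum
        free_carrier_zf free_carrier_zf_star)
qed

text \<open>The relators in two unstarred letters have charge \<open>2\<close>; all others,
  including the sphere relation with its constant \<open>1\<close>, have charge
  \<open>0\<close>.\<close>

lemma sphere_relators_homog:
  assumes "x \<in> sphere_relators n q"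
  shows "\<exists>d. homog d x"
proof -
  have 1: "homog 2 (zf i * zf j)" for i j
    using homog_mult[OF homog_zf homog_zf, of i j] by simp
  have 2: "homog 0 (zf i * zf_star j)" "homog 0 (zf_star i * zf j)" for i j
    using homog_mult[OF homog_zf homog_zf_star, of i j] homog_mult[OF homog_zf_star homog_zf, of i j]
    by simp_all
  from assms show ?thesis
  proof (cases rule: sphere_relators_cases)
    case (zz i j)
    then show ?thesis by (auto intro!: exI[of _ 2] homog_diff homog_scale 1)
  qed (auto intro!: exI[of _ 0] homog_diff homog_scale homog_sum 2)
qed

lemma ideal_sphere_ideal: "ideal I (free_star_algebra n)"
  unfolding sphere_ideal_def
  by (rule ring.genideal_ideal[OF ring_free_star_algebra])
    (use sphere_relators_carrier in auto)

lemma sphere_ideal_relators: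
  "x \<in> sphere_relators n q \<Longrightarrow> x \<in> I" "x \<in> sphere_relators n q \<Longrightarrow> free_star x \<in> I"
proof -
  have "sphere_relators n q \<union> free_star ` sphere_relators n q \<subseteq> I"
    unfolding sphere_ideal_def
    by (rule ring.genideal_self[OF ring_free_star_algebra])
      (use sphere_relators_carrier in auto)
  then show "x \<in> sphere_relators n q \<Longrightarrow> x \<in> I" "x \<in> sphere_relators n q \<Longrightarrow> free_star x \<in> I"
    by auto
qed

lemma sphere_ideal_carrier: "p \<in> I \<Longrightarrow> p \<in> Fc"
  using ideal.Icarr[OF ideal_sphere_ideal] by simp

lemma sphere_ideal_zero [simp]: "0 \<in> I"
  using additive_subgroup.zero_closed[OF ideal.axioms(1)[OF ideal_sphere_ideal]] by simp

lemma sphere_ideal_add: "p \<in> I \<Longrightarrow> p' \<in> I \<Longrightarrow> p + p' \<in> I"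
  using additive_subgroup.a_closed[OF ideal.axioms(1)[OF ideal_sphere_ideal]] by simp

lemma sphere_ideal_mult_left: "a \<in> Fc \<Longrightarrow> p \<in> I \<Longrightarrow> a * p \<in> I"
  using ideal.I_l_closed[OF ideal_sphere_ideal] by simp

lemma sphere_ideal_mult_right: "a \<in> Fc \<Longrightarrow> p \<in> I \<Longrightarrow> p * a \<in> I"
  using ideal.I_r_closed[OF ideal_sphere_ideal] by simp

lemma sphere_ideal_scale: "p \<in> I \<Longrightarrow> scale c p \<in> I"
  using sphere_ideal_mult_left[of "scale c 1" p] by (auto simp: scale_mult_left)

lemma sphere_ideal_uminus: "p \<in> I \<Longrightarrow> - p \<in> I"
  using sphere_ideal_scale[of p "- 1"] by (simp add: scale_minus_one)

lemma sphere_ideal_diff: "p \<in> I \<Longrightarrow> p' \<in> I \<Longrightarrow> p - p' \<in> I"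
  using sphere_ideal_add[of p "- p'"] sphere_ideal_uminus by simp

text \<open>This is the induction principle for the ideal; closure under negatives is the case
  \<open>a = - 1\<close> of multiplication.\<close>

lemma sphere_ideal_minimal:
  assumes sub: "J \<subseteq> Fc" and J0: "0 \<in> J"
    and add: "\<And>p p'. p \<in> J \<Longrightarrow> p' \<in> J \<Longrightarrow> p + p' \<in> J"
    and mult: "\<And>a p. a \<in> Fc \<Longrightarrow> p \<in> J \<Longrightarrow> a * p \<in> J" "\<And>a p. a \<in> Fc \<Longrightarrow> p \<in> J \<Longrightarrow> p * a \<in> J"
    and rel: "\<And>x. x \<in> sphere_relators n q \<Longrightarrow> x \<in> J"
      "\<And>x. x \<in> sphere_relators n q \<Longrightarrow> free_star x \<in> J"
  shows "I \<subseteq> J"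
  unfolding sphere_ideal_def
proof (rule ring.genideal_minimal[OF ring_free_star_algebra])
  interpret ring "free_star_algebra n" by (rule ring_free_star_algebra)
  have "- p \<in> J" if "p \<in> J" for p
    using mult(1)[of "- 1" p] that by auto
  then have "subgroup J (add_monoid (free_star_algebra n))"
    using sub J0 by (intro add.subgroupI) (auto simp: add a_inv_free_star_algebra simp flip: a_inv_def)
  then show "ideal J (free_star_algebra n)"
    by (intro idealI ring_free_star_algebra) (auto simp: mult)
qed (use rel in auto)

text \<open>The generating set is closed under the involution, which interchanges left and right
  multiplication.\<close>

lemma sphere_ideal_star:
  assumes "p \<in> I"
  shows "free_star p \<in> I"
proof -
  have "I \<subseteq> {p \<in> Fc. free_star p \<in> I}"
    by (rule sphere_ideal_minimal)
      (auto simp: free_star_add free_star_mult sphere_ideal_relators sphere_ideal_add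
        sphere_ideal_carrier
        intro: sphere_ideal_mult_left sphere_ideal_mult_right
        dest: subsetD[OF sphere_relators_carrier])
  then show ?thesis
    using assms by auto
qed

text \<open>The relators are homogeneous, so a multiplier acts on them by a scalar. The set
  \<open>?J\<close> has to quantify over all \<open>g\<close>, because multiplying by a word
  replaces \<open>g\<close> by a shift of it.\<close>

lemma sphere_ideal_charge_mult:
  assumes "p \<in> I"
  shows "charge_mult g p \<in> I"
proof -
  let ?J = "{p \<in> Fc. \<forall>g. charge_mult g p \<in> I}"
  have "I \<subseteq> ?J"
  proof (rule sphere_ideal_minimal)
    fix a p assume a: "a \<in> Fc" and p: "p \<in> ?J"
    have w: "Poly_Mapping.single w c \<in> Fc" if "w \<in> Poly_Mapping.keys a" for w c
      using a that by (auto simp: free_carrier_def)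
    have "\<forall>g. charge_mult g (a * p) \<in> I"
    proof (induction a rule: poly_mapping_single_induct)
      case (single u c)
      then show ?case
        using p w by (auto simp: charge_mult_single_mult intro: sphere_ideal_mult_left)
    qed (auto simp: distrib_right charge_mult_add intro: sphere_ideal_add)
    then show "a * p \<in> ?J"
      using a p by auto
    have "\<forall>g. charge_mult g (p * a) \<in> I"
    proof (induction a rule: poly_mapping_single_induct)
      case (single u c)
      then show ?case
        using p w by (auto simp: charge_mult_mult_single intro: sphere_ideal_mult_right)
    qed (auto simp: distrib_left charge_mult_add intro: sphere_ideal_add)
    then show "p * a \<in> ?J"
      using a p by auto
  next
    fix x assume x: "x \<in> sphere_relators n q"
    then obtain d where d: "homog d x"
      using sphere_relators_homog by blast
    show "x \<in> ?J" "free_star x \<in> ?J"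
      using d x subsetD[OF sphere_relators_carrier x]
      by (auto simp: homog_charge_mult[OF d] homog_charge_mult[OF homog_free_star[OF d]]
          intro: sphere_ideal_scale sphere_ideal_relators)
  qed (auto simp: charge_mult_add intro: sphere_ideal_add)
  then show ?thesis
    using assms by auto
qed

section \<open>Elements of the sphere as classes of free elements\<close>

definition cls :: "free_alg \<Rightarrow> free_alg set" where
  "cls p = I +>\<^bsub>free_star_algebra n\<^esub> p"

lemma z_eq_cls: "z n q i = cls (zf i)"
  by (simp add: z_def cls_def)

lemma mem_cls_iff: "x \<in> cls p \<longleftrightarrow> x - p \<in> I"
proof -
  have "x \<in> cls p \<longleftrightarrow> (\<exists>h\<in>I. x = h + p)"
    by (simp add: cls_def a_r_coset_def r_coset_def)
  also have "\<dots> \<longleftrightarrow> x - p \<in> I"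
    by (metis add_diff_cancel_right' diff_add_cancel)
  finally show ?thesis .
qed

lemma cls_eq_iff:
  "cls p = cls p' \<longleftrightarrow> p - p' \<in> I"
proof
  assume "cls p = cls p'"
  moreover have "p \<in> cls p"
    by (simp add: mem_cls_iff)
  ultimately show "p - p' \<in> I"
    by (simp add: mem_cls_iff)
next
  assume *: "p - p' \<in> I"
  show "cls p = cls p'"
  proof (rule Set.set_eqI)
    fix x
    show "x \<in> cls p \<longleftrightarrow> x \<in> cls p'"
      using sphere_ideal_add[of "x - p" "p - p'"] sphere_ideal_diff[of "x - p'" "p - p'"] *
      by (auto simp: mem_cls_iff)
  qed
qed

text \<open>All members of the union defining \<open>coset_map\<close> are the same coset, since
  \<open>f\<close> maps differences in the ideal to differences in the ideal.\<close>

lemma coset_map_cls: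
  assumes "\<And>x x'. f (x - x') = f x - f x'" "\<And>x. x \<in> I \<Longrightarrow> f x \<in> I"
  shows "coset_map (free_star_algebra n) I f (cls p) = cls (f p)"
proof -
  have "cls (f x) = cls (f p)" if "x \<in> cls p" for x
    using that assms(2)[of "x - p"] by (simp add: mem_cls_iff cls_eq_iff assms(1))
  moreover have "p \<in> cls p"
    by (simp add: mem_cls_iff)
  ultimately show ?thesis
    unfolding coset_map_def cls_def[symmetric] by blast
qed

lemma sphere_carrier: "carrier A = cls ` Fc"
  by (auto simp: sphere_def Let_def FactRing_simps cls_def)

lemma cls_closed [intro]: "p \<in> Fc \<Longrightarrow> cls p \<in> carrier A"
  by (simp add: sphere_carrier)

lemma sphere_one: "\<one>\<^bsub>A\<^esub> = cls 1"
  by (simp add: sphere_def Let_def FactRing_simps cls_def)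

lemma sphere_zero: "\<zero>\<^bsub>A\<^esub> = cls 0"
  by (auto simp: sphere_def Let_def FactRing_simps mem_cls_iff)

lemma sphere_mult: "p \<in> Fc \<Longrightarrow> p' \<in> Fc \<Longrightarrow> cls p \<otimes>\<^bsub>A\<^esub> cls p' = cls (p * p')"
  using ideal.rcoset_mult_add[OF ideal_sphere_ideal, of p p']
  by (simp add: sphere_def Let_def FactRing_simps cls_def)

lemma sphere_add: "p \<in> Fc \<Longrightarrow> p' \<in> Fc \<Longrightarrow> cls p \<oplus>\<^bsub>A\<^esub> cls p' = cls (p + p')"
  using abelian_subgroup.a_rcos_sum[OF abelian_subgroupI3[OF ideal.axioms(1)[OF ideal_sphere_ideal]
      ring.is_abelian_group[OF ring_free_star_algebra]], of p p']
  by (simp add: sphere_def Let_def FactRing_simps cls_def)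

lemma sphere_smult: "c \<odot>\<^bsub>A\<^esub> cls p = cls (scale c p)"
  by (simp add: sphere_def Let_def coset_map_cls scale_diff_right sphere_ideal_scale)

lemma sphere_star: "star A (cls p) = cls (free_star p)"
  by (simp add: sphere_def Let_def coset_map_cls free_star_diff sphere_ideal_star)

lemmas sphere_simps = sphere_carrier sphere_one sphere_zero sphere_mult sphere_add sphere_smult
  sphere_star

lemma complex_star_algebra_sphere: "complex_star_algebra A"
proof -
  have F: "scale c p \<in> Fc" "free_star p \<in> Fc" "p + p' \<in> Fc" "p * p' \<in> Fc"
    if "p \<in> Fc" "p' \<in> Fc" for c p p'
    using that by auto
  have ab: "abelian_group A"
  proof (rule abelian_groupI)
    fix x assume "x \<in> carrier A"
    then obtain p where "p \<in> Fc" "x = cls p"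
      by (auto simp: sphere_carrier)
    then show "\<exists>y\<in>carrier A. y \<oplus>\<^bsub>A\<^esub> x = \<zero>\<^bsub>A\<^esub>"
      by (intro bexI[of _ "cls (- p)"]) (auto simp: sphere_simps free_carrier_uminus)
  qed (auto simp: sphere_simps F add_ac)
  show ?thesis
  proof (intro complex_star_algebra.intro complex_star_algebra_axioms.intro)
    show "ring A"
    proof (rule ringI[OF ab])
      show "Group.monoid A"
        by (rule monoidI) (auto simp: sphere_simps F mult.assoc)
    qed (auto simp: sphere_simps F distrib_left distrib_right)
    show "module complex_ring A"
      by (rule moduleI[OF cring_from_type_algebra ab])
        (auto simp: sphere_simps F scale_add_right scale_add_left ring_of_type_algebra_def)
  qed (auto simp: sphere_simps F scale_mult_left scale_mult_right free_star_add free_star_mult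
      free_star_scale)
qed

lemma ring_sphere: "ring A"
  using complex_star_algebra_sphere by (rule complex_star_algebra.axioms)

lemma sphere_finsum:
  assumes "finite S" "\<And>i. i \<in> S \<Longrightarrow> f i \<in> Fc"
  shows "finsum A (\<lambda>i. cls (f i)) S = cls (\<Sum>i\<in>S. f i)"
proof -
  interpret ring A by (rule ring_sphere)
  show ?thesis
    using assms
  proof (induction S)
    case empty
    then show ?case by (simp add: sphere_zero)
  next
    case (insert i S)
    have "finsum A (\<lambda>i. cls (f i)) (insert i S) = cls (f i) \<oplus>\<^bsub>A\<^esub> finsum A (\<lambda>i. cls (f i)) S"
      using insert by (intro finsum_insert) auto
    also have "\<dots> = cls (f i) \<oplus>\<^bsub>A\<^esub> cls (\<Sum>i\<in>S. f i)"
      using insert by simp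
    also have "\<dots> = cls (\<Sum>i\<in>insert i S. f i)"
      using insert by (subst sphere_add) auto
    finally show ?case .
  qed
qed

lemma sphere_pow: "p \<in> Fc \<Longrightarrow> cls p [^]\<^bsub>A\<^esub> (k :: nat) = cls (p ^ k)"
proof (induction k)
  case 0
  show ?case by (simp add: nat_pow_def sphere_one)
next
  case (Suc k)
  interpret ring A by (rule ring_sphere)
  show ?case
    using Suc by (simp add: sphere_mult free_carrier_power power_commutes)
qed

lemma sphere_ordered_prod:
  assumes "\<And>a. a \<le> n \<Longrightarrow> f a \<in> Fc"
  shows "ordered_prod A n (\<lambda>a. cls (f a)) = cls (\<Prod>a\<leftarrow>[0..<Suc n]. f a)"
proof -
  have "foldr (monoid.mult A) (map (\<lambda>a. cls (f a)) as) \<one>\<^bsub>A\<^esub> = cls (\<Prod>a\<leftarrow>as. f a)"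
    if "set as \<subseteq> {..n}" for as
    using that
  proof (induction as)
    case (Cons a as)
    then have "(\<Prod>a\<leftarrow>as. f a) \<in> Fc"
      using assms by (intro free_carrier_prod_list) auto
    then show ?case
      using Cons assms by (auto simp: sphere_mult)
  qed (simp add: sphere_one)
  moreover have "set [0..<Suc n] \<subseteq> {..n}"
    by auto
  ultimately show ?thesis
    unfolding ordered_prod_def by blast
qed

end

section \<open>The quantum projective space is the part of charge zero\<close>

context quantum_sphere
begin

text \<open>A linear subspace that contains the ideal and thus cannot distinguish elements equal in
  the sphere. Showing that such a subspace contains \<open>p\<close> as soon as it contains certain
  products says that \<open>p\<close> is a combination of them modulo the relations.\<close>

definition lin_closed :: "free_alg set \<Rightarrow> bool" where
  "lin_closed L \<longleftrightarrow> I \<subseteq> L \<and> (\<forall>p\<in>L. \<forall>p'\<in>L. p + p' \<in> L) \<and> (\<forall>c. \<forall>p\<in>L. scale c p \<in> L)"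

lemma lin_closed_add: "lin_closed L \<Longrightarrow> p \<in> L \<Longrightarrow> p' \<in> L \<Longrightarrow> p + p' \<in> L"
  and lin_closed_scale: "lin_closed L \<Longrightarrow> p \<in> L \<Longrightarrow> scale c p \<in> L"
  and lin_closed_ideal: "lin_closed L \<Longrightarrow> p \<in> I \<Longrightarrow> p \<in> L"
  by (auto simp: lin_closed_def)

lemma lin_closed_diff: "lin_closed L \<Longrightarrow> p \<in> L \<Longrightarrow> p' \<in> L \<Longrightarrow> p - p' \<in> L"
  using lin_closed_add[of L p "- p'"] lin_closed_scale[of L p' "- 1"] by (simp add: scale_minus_one)

lemma lin_closed_zero: "lin_closed L \<Longrightarrow> 0 \<in> L"
  by (rule lin_closed_ideal) auto

lemma lin_closed_sum: "lin_closed L \<Longrightarrow> (\<And>i. i \<in> S \<Longrightarrow> f i \<in> L) \<Longrightarrow> (\<Sum>i\<in>S. f i) \<in> L"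
  by (induction S rule: infinite_finite_induct) (auto intro: lin_closed_add lin_closed_zero)

lemma lin_closed_cong: "lin_closed L \<Longrightarrow> p - p' \<in> I \<Longrightarrow> p' \<in> L \<Longrightarrow> p \<in> L"
  using lin_closed_add[of L "p - p'" p'] lin_closed_ideal[of L "p - p'"] by simp

text \<open>This allows an exchange of two letters to take place in the middle of a word.\<close>

lemma lin_closed_sandwich:
  "lin_closed L \<Longrightarrow> u \<in> Fc \<Longrightarrow> v \<in> Fc \<Longrightarrow> lin_closed {p. u * p * v \<in> L}"
  by (auto simp: lin_closed_def distrib_left distrib_right scale_mult_left scale_mult_right
      intro!: sphere_ideal_mult_left sphere_ideal_mult_right)

section \<open>Exchange of starred and unstarred letters\<close>

lemma rel_zz: "i < j \<Longrightarrow> j \<le> n \<Longrightarrow>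
    zf i * zf j - scale (complex_of_real (inverse q)) (zf j * zf i) \<in> I"
  by (rule sphere_ideal_relators(1)) (auto simp: sphere_relators_def)

lemma rel_sz: "i \<le> n \<Longrightarrow> j \<le> n \<Longrightarrow> i \<noteq> j \<Longrightarrow>
    zf_star i * zf j - scale (complex_of_real q) (zf j * zf_star i) \<in> I"
  by (rule sphere_ideal_relators(1)) (auto simp: sphere_relators_def)

lemma rel_commutator:
  assumes "i \<le> n"
  shows "zf_star i * zf i - zf i * zf_star i
    - scale (complex_of_real (1 - q\<^sup>2)) (\<Sum>j\<in>{i<..n}. zf j * zf_star j) \<in> I"
proof (cases "i = n")
  case True
  have "zf_star n * zf n - zf n * zf_star n \<in> I"
    by (rule sphere_ideal_relators(1)) (auto simp: sphere_relators_def)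
  then show ?thesis
    using True by simp
next
  case False
  then have "i < n"
    using assms by simp
  then show ?thesis
    by (intro sphere_ideal_relators(1)) (unfold sphere_relators_def, blast)
qed

lemma rel_unit: "(\<Sum>i\<le>n. zf i * zf_star i) - 1 \<in> I"
  by (rule sphere_ideal_relators(1)) (auto simp: sphere_relators_def)

lemma lin_closed_swap_sz:
  assumes L: "lin_closed L" and zs: "\<And>i j. i \<le> n \<Longrightarrow> j \<le> n \<Longrightarrow> zf i * zf_star j \<in> L"
    and "i \<le> n" "j \<le> n"
  shows "zf_star i * zf j \<in> L"
proof (cases "i = j")
  case True
  let ?s = "scale (complex_of_real (1 - q\<^sup>2)) (\<Sum>k\<in>{i<..n}. zf k * zf_star k)"
  have "?s \<in> L"
    using L zs by (intro lin_closed_scale lin_closed_sum) auto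
  then have "zf i * zf_star i + ?s \<in> L"
    using L zs assms by (intro lin_closed_add) auto
  then show ?thesis
    using lin_closed_cong[OF L, of "zf_star i * zf i" "zf i * zf_star i + ?s"]
      rel_commutator[OF assms(3)] True by (simp add: diff_diff_add)
next
  case False
  then show ?thesis
    using lin_closed_cong[OF L rel_sz] lin_closed_scale[OF L zs] assms by blast
qed

text \<open>The diagonal case runs by downward induction on \<open>i\<close>: the commutator
  relation expresses \<open>zf i * zf_star i\<close> by \<open>zf_star i * zf i\<close> and the
  products \<open>zf k * zf_star k\<close> with \<open>k > i\<close>, which are already in
  \<open>L\<close>. For \<open>i = n\<close> the sum is empty.\<close>

lemma lin_closed_swap_zs:
  assumes L: "lin_closed L" and sz: "\<And>i j. i \<le> n \<Longrightarrow> j \<le> n \<Longrightarrow> zf_star i * zf j \<in> L"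
    and "i \<le> n" "j \<le> n"
  shows "zf i * zf_star j \<in> L"
proof -
  have diag: "zf i * zf_star i \<in> L" if "i \<le> n" for i
    using that
  proof (induction "n - i" arbitrary: i rule: less_induct)
    case less
    let ?s = "scale (complex_of_real (1 - q\<^sup>2)) (\<Sum>k\<in>{i<..n}. zf k * zf_star k)"
    have "?s \<in> L"
      using L less by (intro lin_closed_scale lin_closed_sum) auto
    then have "zf_star i * zf i - ?s \<in> L"
      using L sz less by (intro lin_closed_diff) auto
    moreover have "zf i * zf_star i - (zf_star i * zf i - ?s) \<in> I"
      using sphere_ideal_uminus[OF rel_commutator[OF less.prems]] by (simp add: algebra_simps)
    ultimately show ?case
      using lin_closed_cong[OF L] by blast
  qed
  show ?thesis
  proof (cases "i = j")
    case False
    \<comment> \<open>The relation for the pair \<open>j\<close>, \<open>i\<close>, solved for its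
      second term; here \<open>q\<close> is inverted.\<close>
    have "scale (- complex_of_real (inverse q))
        (zf_star j * zf i - scale (complex_of_real q) (zf i * zf_star j)) \<in> I"
      using False assms by (intro sphere_ideal_scale rel_sz) auto
    moreover have "scale (- complex_of_real (inverse q))
        (zf_star j * zf i - scale (complex_of_real q) (zf i * zf_star j)) =
        zf i * zf_star j - scale (complex_of_real (inverse q)) (zf_star j * zf i)"
      using q_pos by (intro poly_mapping_eqI) (simp add: lookup_scale lookup_minus field_simps)
    ultimately show ?thesis
      using lin_closed_cong[OF L _ lin_closed_scale[OF L sz]] assms by metis
  qed (use diag assms in auto)
qed

lemma lin_closed_unit:
  assumes "lin_closed L" "\<And>i. i \<le> n \<Longrightarrow> zf i * zf_star i \<in> L"
  shows "1 \<in> L"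
proof -
  have "1 - (\<Sum>i\<le>n. zf i * zf_star i) \<in> I"
    using sphere_ideal_uminus[OF rel_unit] by simp
  then show ?thesis
    by (rule lin_closed_cong[OF assms(1) _ lin_closed_sum[OF assms(1)]]) (auto intro: assms(2))
qed

definition letter_elem :: "letter \<Rightarrow> free_alg" where
  "letter_elem l = Poly_Mapping.single (Word [l]) 1"

lemma letter_elem_simps [simp]: "letter_elem (Z i) = zf i" "letter_elem (Zstar i) = zf_star i"
  by (simp_all add: letter_elem_def zf_def zf_star_def)

lemma single_word_eq: "Poly_Mapping.single (Word ls) 1 = (\<Prod>l\<leftarrow>ls. letter_elem l)"
proof (induction ls)
  case Nil
  then show ?case by (simp flip: zero_word_def)
next
  case (Cons l ls)
  have "Poly_Mapping.single (Word (l # ls)) 1 =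
      letter_elem l * Poly_Mapping.single (Word ls) 1"
    by (simp add: letter_elem_def mult_single plus_word_def)
  with Cons show ?case by simp
qed

lemma charge_Word_append: "charge (Word (us @ vs)) = charge (Word us) + charge (Word vs)"
  by (simp add: charge_def)

lemma charge_Word_Cons: "charge (Word (l # ls)) = charge (Word [l]) + charge (Word ls)"
  by (simp add: charge_def)

lemma charge_letter: "charge (Word [l]) = 1 \<or> charge (Word [l]) = - 1"
  by (cases l) (simp_all add: charge_def)

definition letters_upto :: "letter set" where
  "letters_upto = Z ` {..n} \<union> Zstar ` {..n}"

lemma letter_elem_carrier: "l \<in> letters_upto \<Longrightarrow> letter_elem l \<in> Fc"
  by (auto simp: letters_upto_def)

text \<open>Both directions of the exchange in one form. Since an exchange may change the indices of
  the letters, the assumption covers all pairs with the same charges in the reversed order.\<close>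

lemma lin_closed_swap:
  assumes L: "lin_closed L" and "a \<in> letters_upto" "b \<in> letters_upto"
    and "charge (Word [a]) = - charge (Word [b])"
    and *: "\<And>a' b'. a' \<in> letters_upto \<Longrightarrow> b' \<in> letters_upto \<Longrightarrow> charge (Word [a']) = charge (Word [a])
      \<Longrightarrow> charge (Word [b']) = charge (Word [b]) \<Longrightarrow> letter_elem b' * letter_elem a' \<in> L"
  shows "letter_elem a * letter_elem b \<in> L"
proof -
  consider i j where "a = Z i" "b = Zstar j" "i \<le> n" "j \<le> n"
    | i j where "a = Zstar i" "b = Z j" "i \<le> n" "j \<le> n"
    using assms(2-4) by (auto simp: letters_upto_def charge_def)
  then show ?thesis
  proof cases
    case 1
    then show ?thesis
      using lin_closed_swap_zs[OF L, of i j] *[of "Z _" "Zstar _"]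
      by (auto simp: letters_upto_def charge_def)
  next
    case 2
    then show ?thesis
      using lin_closed_swap_sz[OF L, of i j] *[of "Zstar _" "Z _"]
      by (auto simp: letters_upto_def charge_def)
  qed
qed

section \<open>The projective space consists of the classes of charge zero\<close>

text \<open>The classes of charge zero form a *-subalgebra that contains the generators, and
  \<open>cp n q\<close> is the smallest such.\<close>

lemma cp_subset_charge_zero: "cp n q \<subseteq> cls ` {p \<in> Fc. homog 0 p}"
proof -
  have "star_subalgebra (cls ` {p \<in> Fc. homog 0 p}) A"
  proof (rule star_subalgebraI[OF complex_star_algebra_sphere])
    fix x y assume "x \<in> cls ` {p \<in> Fc. homog 0 p}" "y \<in> cls ` {p \<in> Fc. homog 0 p}"
    then obtain p p' where "p \<in> Fc" "homog 0 p" "x = cls p" "p' \<in> Fc" "homog 0 p'" "y = cls p'"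
      by blast
    then show "x \<oplus>\<^bsub>A\<^esub> y \<in> cls ` {p \<in> Fc. homog 0 p}" "x \<otimes>\<^bsub>A\<^esub> y \<in> cls ` {p \<in> Fc. homog 0 p}"
      using homog_mult[of 0 p 0 p'] by (auto simp: sphere_add sphere_mult homog_add)
  next
    fix c x assume "x \<in> cls ` {p \<in> Fc. homog 0 p}"
    then show "c \<odot>\<^bsub>A\<^esub> x \<in> cls ` {p \<in> Fc. homog 0 p}" "star A x \<in> cls ` {p \<in> Fc. homog 0 p}"
      using homog_free_star[of 0]
      by (auto simp: sphere_smult sphere_star homog_scale)
  qed (auto simp: sphere_one)
  moreover have "star A (z n q i) \<otimes>\<^bsub>A\<^esub> z n q j \<in> cls ` {p \<in> Fc. homog 0 p}"
    if "i \<le> n" "j \<le> n" for i j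
    using that homog_mult[OF homog_zf_star homog_zf, of i j]
    by (auto simp: z_eq_cls sphere_star sphere_mult free_carrier_zf free_carrier_zf_star)
  ultimately show ?thesis
    unfolding cp_def gen_star_subalgebra_def by blast
qed

definition cp_lift :: "free_alg set" where
  "cp_lift = {p \<in> Fc. cls p \<in> cp n q}"

lemma cp_closed:
  shows "\<one>\<^bsub>A\<^esub> \<in> cp n q"
    and "x \<in> cp n q \<Longrightarrow> y \<in> cp n q \<Longrightarrow> x \<oplus>\<^bsub>A\<^esub> y \<in> cp n q"
    and "x \<in> cp n q \<Longrightarrow> y \<in> cp n q \<Longrightarrow> x \<otimes>\<^bsub>A\<^esub> y \<in> cp n q"
    and "x \<in> cp n q \<Longrightarrow> c \<odot>\<^bsub>A\<^esub> x \<in> cp n q"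
  using star_subalgebraD[of _ A] unfolding cp_def gen_star_subalgebra_def
  by (simp_all add: Inter_iff)

lemma cp_lift_one: "1 \<in> cp_lift"
  using cp_closed(1) by (auto simp: cp_lift_def sphere_one)

lemma cp_lift_mult: "p \<in> cp_lift \<Longrightarrow> p' \<in> cp_lift \<Longrightarrow> p * p' \<in> cp_lift"
  using cp_closed(3)[of "cls p" "cls p'"] by (auto simp: cp_lift_def sphere_mult)

lemma lin_closed_cp_lift: "lin_closed cp_lift"
proof -
  have scale: "scale c p \<in> cp_lift" if "p \<in> cp_lift" for c p
    using that cp_closed(4)[of "cls p"] by (auto simp: cp_lift_def sphere_smult)
  have "cls 0 \<in> cp n q"
    using scale[OF cp_lift_one, of 0] by (simp add: cp_lift_def)
  then have "p \<in> cp_lift" if "p \<in> I" for p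
    using that cls_eq_iff[of p 0] by (simp add: cp_lift_def sphere_ideal_carrier)
  moreover have "p + p' \<in> cp_lift" if "p \<in> cp_lift" "p' \<in> cp_lift" for p p'
    using that cp_closed(2)[of "cls p" "cls p'"] by (auto simp: cp_lift_def sphere_add)
  ultimately show ?thesis
    using scale by (auto simp: lin_closed_def)
qed

lemma cp_lift_sz: "i \<le> n \<Longrightarrow> j \<le> n \<Longrightarrow> zf_star i * zf j \<in> cp_lift"
proof -
  assume ij: "i \<le> n" "j \<le> n"
  have "star A (z n q i) \<otimes>\<^bsub>A\<^esub> z n q j \<in> cp n q"
    unfolding cp_def gen_star_subalgebra_def using ij by blast
  then show "zf_star i * zf j \<in> cp_lift"
    using ij free_carrier_zf[of i n] free_carrier_zf[of j n] free_carrier_zf_star[of i n]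
    by (auto simp: cp_lift_def z_eq_cls sphere_star sphere_mult)
qed

lemma cp_lift_pair:
  assumes "a \<in> letters_upto" "b \<in> letters_upto" "charge (Word [a]) = - charge (Word [b])"
  shows "letter_elem a * letter_elem b \<in> cp_lift"
proof -
  have "zf i * zf_star j \<in> cp_lift" if "i \<le> n" "j \<le> n" for i j
    using lin_closed_swap_zs[OF lin_closed_cp_lift cp_lift_sz] that by blast
  then show ?thesis
    using assms cp_lift_sz by (auto simp: letters_upto_def charge_def)
qed

text \<open>The leftmost letter that has the sign opposite to the initial one can be moved to the
  second position; the first two letters then form an element of the projective space.\<close>

lemma cp_lift_charge_zero_word:
  assumes "set ls \<subseteq> letters_upto" "charge (Word ls) = 0"
  shows "(\<Prod>l\<leftarrow>ls. letter_elem l) \<in> cp_lift"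
  using assms
proof (induction "length ls" arbitrary: ls rule: less_induct)
  case less
  note outer = less.hyps
  have carr: "(\<Prod>l\<leftarrow>us. letter_elem l) \<in> Fc" if "set us \<subseteq> letters_upto" for us
    using that by (intro free_carrier_prod_list letter_elem_carrier) auto
  \<comment> \<open>Inner induction on the block \<open>us\<close> in front of \<open>b\<close>. An
    exchange shortens the block while total charge and length stay the same; when one letter is
    left, it forms a pair with \<open>b\<close> and the outer hypothesis applies to
    \<open>vs\<close>, which is two letters shorter than \<open>ls\<close>.\<close>
  have *: "(\<Prod>l\<leftarrow>us @ b # vs. letter_elem l) \<in> cp_lift"
    if "us \<noteq> []" "set (us @ b # vs) \<subseteq> letters_upto"
      "\<And>a. a \<in> set us \<Longrightarrow> charge (Word [a]) = - charge (Word [b])"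
      "length (us @ b # vs) = length ls" "charge (Word (us @ b # vs)) = 0" for us b vs
    using that
  proof (induction us arbitrary: b vs rule: rev_induct)
    case Nil
    then show ?case by simp
  next
    case (snoc a us)
    have ab: "a \<in> letters_upto" "b \<in> letters_upto" "charge (Word [a]) = - charge (Word [b])"
      using snoc.prems by auto
    show ?case
    proof (cases "us = []")
      case True
      then have "(\<Prod>l\<leftarrow>vs. letter_elem l) \<in> cp_lift"
        using snoc.prems ab by (intro outer) (auto simp: charge_Word_Cons[of a "b # vs"] charge_Word_Cons[of b vs])
      then show ?thesis
        using cp_lift_mult[OF cp_lift_pair[OF ab]] True by (simp add: mult.assoc)
    next
      case False
      let ?L = "{p. (\<Prod>l\<leftarrow>us. letter_elem l) * p * (\<Prod>l\<leftarrow>vs. letter_elem l) \<in> cp_lift}"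
      have "lin_closed ?L"
        using snoc.prems by (intro lin_closed_sandwich lin_closed_cp_lift carr) auto
      then have "letter_elem a * letter_elem b \<in> ?L"
      proof (rule lin_closed_swap[OF _ ab])
        fix a' b'
        assume a'b': "a' \<in> letters_upto" "b' \<in> letters_upto"
          "charge (Word [a']) = charge (Word [a])" "charge (Word [b']) = charge (Word [b])"
        have "(\<Prod>l\<leftarrow>us @ b' # (a' # vs). letter_elem l) \<in> cp_lift"
        proof (rule snoc.IH[OF False])
          show "charge (Word (us @ b' # a' # vs)) = 0"
            using snoc.prems(5) a'b'
            by (simp add: charge_Word_append charge_Word_Cons[of _ "_ # _"] charge_Word_Cons[of _ vs])
        qed (use snoc.prems a'b' in auto)
        then show "letter_elem b' * letter_elem a' \<in> ?L"
          by (simp add: mult.assoc)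
      qed
      then show ?thesis
        by (simp add: mult.assoc)
    qed
  qed
  show ?case
  proof (cases ls)
    case Nil
    then show ?thesis by (simp add: cp_lift_one)
  next
    case (Cons a ls')
    let ?P = "\<lambda>l. charge (Word [l]) = charge (Word [a])"
    \<comment> \<open>A nonempty word whose letters all have one sign has charge plus or minus its
      length, which is not zero.\<close>
    have "dropWhile ?P ls \<noteq> []"
    proof
      assume "dropWhile ?P ls = []"
      then have same: "\<forall>l\<in>set ls. ?P l"
        by simp
      have "charge (Word us) = int (length us) * charge (Word [a])" if "\<forall>l\<in>set us. ?P l" for us
        using that
      proof (induction us)
        case (Cons l us)
        then show ?case by (simp add: charge_Word_Cons[of l us] algebra_simps)
      qed (simp add: charge_def)
      from this[OF same] have "int (length ls) * charge (Word [a]) = 0"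
        using less.prems(2) by simp
      then show False
        using charge_letter[of a] Cons by auto
    qed
    then obtain b vs where bvs: "dropWhile ?P ls = b # vs"
      by (cases "dropWhile ?P ls") auto
    have ls: "takeWhile ?P ls @ b # vs = ls"
      using takeWhile_dropWhile_id[of ?P ls] bvs by simp
    have "\<not> ?P b"
      using hd_dropWhile[of ?P ls] bvs by simp
    then have opp: "charge (Word [a]) = - charge (Word [b])"
      using charge_letter[of a] charge_letter[of b] by auto
    have "(\<Prod>l\<leftarrow>takeWhile ?P ls @ b # vs. letter_elem l) \<in> cp_lift"
    proof (rule *)
      show "takeWhile ?P ls \<noteq> []"
        using Cons by simp
      show "charge (Word [c]) = - charge (Word [b])" if "c \<in> set (takeWhile ?P ls)" for c
        using set_takeWhileD[OF that] opp by simp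
    qed (use less.prems ls in simp_all)
    then show ?thesis
      using ls by simp
  qed
qed

lemma cp_eq: "cp n q = cls ` {p \<in> Fc. homog 0 p}"
proof -
  have "p \<in> cp_lift" if p: "p \<in> Fc" "homog 0 p" for p
  proof (induction p rule: poly_mapping_single_induct)
    case (single w c)
    then have "(\<Prod>l\<leftarrow>letters w. letter_elem l) \<in> cp_lift"
      using p by (intro cp_lift_charge_zero_word)
        (auto simp: homog_def free_carrier_def letters_upto_def)
    then have "Poly_Mapping.single w 1 \<in> cp_lift"
      using single_word_eq[of "letters w"] by simp
    then show ?case
      using lin_closed_scale[OF lin_closed_cp_lift] single_eq_scale[of w c] by metis
  qed (auto intro: lin_closed_zero lin_closed_add lin_closed_cp_lift)
  then show ?thesis
    using cp_subset_charge_zero by (auto simp: cp_lift_def)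
qed

section \<open>The line bundles are the homogeneous parts\<close>

text \<open>The scalar stays anonymous: it depends on the order of the indices and on the kind of
  letter, and is finally absorbed into a coefficient of charge zero.\<close>

definition qcomm :: "free_alg \<Rightarrow> free_alg \<Rightarrow> bool" where
  "qcomm x y \<longleftrightarrow> (\<exists>c. x * y - scale c (y * x) \<in> I)"

lemma qcomm_mult:
  assumes "x \<in> Fc" "a \<in> Fc" "b \<in> Fc" "qcomm x a" "qcomm x b"
  shows "qcomm x (a * b)"
proof -
  obtain c d where c: "x * a - scale c (a * x) \<in> I" and d: "x * b - scale d (b * x) \<in> I"
    using assms by (auto simp: qcomm_def)
  \<comment> \<open>First \<open>x\<close> moves past \<open>a\<close>, then past \<open>b\<close>;
    the intermediate terms \<open>scale c (a * x * b)\<close> cancel and the scalars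
    multiply.\<close>
  have "(x * a - scale c (a * x)) * b + scale c (a * (x * b - scale d (b * x))) \<in> I"
    using c d assms
    by (intro sphere_ideal_add sphere_ideal_scale sphere_ideal_mult_left sphere_ideal_mult_right)
  also have "(x * a - scale c (a * x)) * b + scale c (a * (x * b - scale d (b * x))) =
      x * (a * b) - scale (c * d) (a * b * x)"
    by (simp add: algebra_simps scale_mult_left scale_mult_right scale_diff_right)
  finally show ?thesis
    unfolding qcomm_def by blast
qed

lemma qcomm_one: "qcomm x 1"
  unfolding qcomm_def by (rule exI[of _ 1]) simp

lemma qcomm_power: "x \<in> Fc \<Longrightarrow> a \<in> Fc \<Longrightarrow> qcomm x a \<Longrightarrow> qcomm x (a ^ k)"
  by (induction k) (auto intro: qcomm_one qcomm_mult)

lemma qcomm_prod_list: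
  assumes "x \<in> Fc"
  shows "(\<And>a. a \<in> set as \<Longrightarrow> f a \<in> Fc \<and> qcomm x (f a)) \<Longrightarrow> qcomm x (\<Prod>a\<leftarrow>as. f a)"
proof (induction as)
  case (Cons a as)
  have "qcomm x (f a * (\<Prod>a\<leftarrow>as. f a))"
    using assms Cons by (intro qcomm_mult) auto
  then show ?case by simp
qed (simp add: qcomm_one)

text \<open>The involution reverses both products and conjugates the scalar, so the roles of
  \<open>x\<close> and \<open>y\<close> are interchanged.\<close>

lemma qcomm_star:
  assumes "qcomm x y"
  shows "qcomm (free_star y) (free_star x)"
proof -
  obtain c where "x * y - scale c (y * x) \<in> I"
    using assms by (auto simp: qcomm_def)
  from sphere_ideal_star[OF this] show ?thesis
    unfolding qcomm_def free_star_diff free_star_scale free_star_mult by blast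
qed

lemma qcomm_zf:
  assumes "i \<le> n" "j \<le> n"
  shows "qcomm (zf i) (zf j)"
proof (cases i j rule: linorder_cases)
  case less
  then show ?thesis
    using rel_zz[of i j] assms unfolding qcomm_def by blast
next
  case equal
  then show ?thesis
    unfolding qcomm_def by (intro exI[of _ 1]) simp
next
  case greater
  have "scale (- complex_of_real q)
      (zf j * zf i - scale (complex_of_real (inverse q)) (zf i * zf j)) \<in> I"
    using greater assms by (intro sphere_ideal_scale rel_zz) auto
  also have "scale (- complex_of_real q)
      (zf j * zf i - scale (complex_of_real (inverse q)) (zf i * zf j)) =
      zf i * zf j - scale (complex_of_real q) (zf j * zf i)"
    using q_pos by (intro poly_mapping_eqI) (simp add: lookup_scale lookup_minus field_simps)
  finally show ?thesis
    unfolding qcomm_def by blast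
qed

lemma qcomm_zf_star: "i \<le> n \<Longrightarrow> j \<le> n \<Longrightarrow> qcomm (zf_star i) (zf_star j)"
  using qcomm_star[OF qcomm_zf, of j i] by simp

section \<open>Reduction to ordered monomials\<close>

definition ordered_monomial :: "(nat \<Rightarrow> free_alg) \<Rightarrow> (nat \<Rightarrow> nat) \<Rightarrow> free_alg" where
  "ordered_monomial y j = (\<Prod>a\<leftarrow>[0..<Suc n]. y a ^ j a)"

lemma ordered_monomial_carrier: "(\<And>i. i \<le> n \<Longrightarrow> y i \<in> Fc) \<Longrightarrow> ordered_monomial y j \<in> Fc"
  unfolding ordered_monomial_def by (auto intro!: free_carrier_prod_list free_carrier_power)

text \<open>The letter \<open>y i\<close> passes the powers of smaller index at the cost of a scalar
  and then joins the power \<open>y i ^ j i\<close>.\<close>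

lemma ordered_monomial_mult_letter:
  assumes y: "\<And>i. i \<le> n \<Longrightarrow> y i \<in> Fc" and comm: "\<And>i j. i \<le> n \<Longrightarrow> j \<le> n \<Longrightarrow> qcomm (y i) (y j)"
    and "i \<le> n"
  shows "\<exists>c. y i * ordered_monomial y j - scale c (ordered_monomial y (j(i := Suc (j i)))) \<in> I"
proof -
  have "[0..<Suc n] = [0..<i] @ i # [Suc i..<Suc n]"
    using \<open>i \<le> n\<close> upt_add_eq_append[of 0 i "Suc n - i"] upt_conv_Cons[of i "Suc n"] by simp
  then have split: "ordered_monomial y j =
      (\<Prod>a\<leftarrow>[0..<i]. y a ^ j a) * y i ^ j i * (\<Prod>a\<leftarrow>[Suc i..<Suc n]. y a ^ j a)" for j
    unfolding ordered_monomial_def by (simp only: map_append list.map prod_list.append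
        prod_list.Cons mult.assoc)
  let ?P = "\<Prod>a\<leftarrow>[0..<i]. y a ^ j a" and ?R = "\<Prod>a\<leftarrow>[Suc i..<Suc n]. y a ^ j a"
  have maps: "map (\<lambda>a. y a ^ (j(i := Suc (j i))) a) [0..<i] = map (\<lambda>a. y a ^ j a) [0..<i]"
    "map (\<lambda>a. y a ^ (j(i := Suc (j i))) a) [Suc i..<Suc n] = map (\<lambda>a. y a ^ j a) [Suc i..<Suc n]"
    by (auto intro!: map_cong simp del: upt_Suc)
  then have upd: "ordered_monomial y (j(i := Suc (j i))) = ?P * (y i * y i ^ j i) * ?R"
    by (simp only: split maps fun_upd_same power_Suc)
  have "qcomm (y i) ?P"
    using assms by (intro qcomm_prod_list) (auto intro: qcomm_power)
  then obtain c where "y i * ?P - scale c (?P * y i) \<in> I"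
    by (auto simp: qcomm_def)
  then have "(y i * ?P - scale c (?P * y i)) * (y i ^ j i * ?R) \<in> I"
    using assms by (intro sphere_ideal_mult_right free_carrier_mult free_carrier_prod_list
        free_carrier_power) auto
  also have "(y i * ?P - scale c (?P * y i)) * (y i ^ j i * ?R) =
      y i * ordered_monomial y j - scale c (ordered_monomial y (j(i := Suc (j i))))"
    by (simp only: upd split[of j] left_diff_distrib scale_mult_left mult.assoc)
  finally show ?thesis
    by blast
qed

lemma ordered_monomial_eq_prod_list:
  assumes y: "\<And>i. i \<le> n \<Longrightarrow> y i \<in> Fc" and comm: "\<And>i j. i \<le> n \<Longrightarrow> j \<le> n \<Longrightarrow> qcomm (y i) (y j)"
    and "set is \<subseteq> {..n}"
  shows "\<exists>c. \<exists>j\<in>multi_indices n (length is).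
    (\<Prod>i\<leftarrow>is. y i) - scale c (ordered_monomial y j) \<in> I"
  using assms(3)
proof (induction "is")
  case Nil
  \<comment> \<open>Restricted to \<open>{..n}\<close>, because multi-indices are extensional
    functions.\<close>
  define j0 :: "nat \<Rightarrow> nat" where "j0 = (\<lambda>a\<in>{..n}. 0)"
  have "map (\<lambda>a. y a ^ j0 a) [0..<Suc n] = map (\<lambda>a. 1) [0..<Suc n]"
    by (rule map_cong) (auto simp: j0_def)
  then have "ordered_monomial y j0 = 1"
    unfolding ordered_monomial_def by (simp del: upt_Suc add: map_replicate_const)
  moreover have "j0 \<in> multi_indices n 0"
    by (auto simp: multi_indices_def j0_def)
  ultimately show ?case
    by (intro exI[of _ 1] bexI[of _ j0]) auto
next
  case (Cons i "is")
  then obtain c j where j: "j \<in> multi_indices n (length is)"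
    and c: "(\<Prod>i\<leftarrow>is. y i) - scale c (ordered_monomial y j) \<in> I"
    by auto
  obtain d where d: "y i * ordered_monomial y j
      - scale d (ordered_monomial y (j(i := Suc (j i)))) \<in> I"
    using ordered_monomial_mult_letter[of y i j, OF y comm] Cons.prems by auto
  have "y i * ((\<Prod>i\<leftarrow>is. y i) - scale c (ordered_monomial y j)) + scale c (y i * ordered_monomial y j
      - scale d (ordered_monomial y (j(i := Suc (j i))))) \<in> I"
    using c d y Cons.prems by (intro sphere_ideal_add sphere_ideal_mult_left sphere_ideal_scale) auto
  also have "y i * ((\<Prod>i\<leftarrow>is. y i) - scale c (ordered_monomial y j)) + scale c (y i * ordered_monomial y j
      - scale d (ordered_monomial y (j(i := Suc (j i))))) =
      (\<Prod>i\<leftarrow>i # is. y i) - scale (c * d) (ordered_monomial y (j(i := Suc (j i))))"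
    by (simp add: right_diff_distrib scale_diff_right scale_mult_right)
  finally have "(\<Prod>i\<leftarrow>i # is. y i) - scale (c * d) (ordered_monomial y (j(i := Suc (j i)))) \<in> I" .
  moreover have "j(i := Suc (j i)) \<in> multi_indices n (length (i # is))"
  proof -
    have i: "i \<in> {..n}"
      using Cons.prems by simp
    then have "(\<Sum>a\<le>n. (j(i := Suc (j i))) a) = Suc (\<Sum>a\<le>n. j a)"
      by (simp add: sum.remove[OF _ i])
    then show ?thesis
      using j i by (auto simp: multi_indices_def PiE_def extensional_def)
  qed
  ultimately show ?case
    by blast
qed

text \<open>Writing \<open>1\<close> as a combination of the \<open>u i * y j\<close> and inserting this \<open>k\<close> times splits off
  \<open>k\<close> letters \<open>y\<close> from the right, which leaves a coefficient of charge zero.\<close>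

lemma lin_closed_factor:
  assumes L: "lin_closed L"
    and y: "\<And>i. i \<le> n \<Longrightarrow> y i \<in> Fc"
    and u: "\<And>i. i \<le> n \<Longrightarrow> u i \<in> Fc" "\<And>i. homog (- d) (u i)"
    and unit: "\<And>L'. lin_closed L' \<Longrightarrow> (\<And>i j. i \<le> n \<Longrightarrow> j \<le> n \<Longrightarrow> u i * y j \<in> L') \<Longrightarrow> 1 \<in> L'"
    and base: "\<And>a is. a \<in> Fc \<Longrightarrow> homog 0 a \<Longrightarrow> length is = k \<Longrightarrow> set is \<subseteq> {..n} \<Longrightarrow>
      a * (\<Prod>i\<leftarrow>is. y i) \<in> L"
    and p: "p \<in> Fc" "homog (int k * d) p"
  shows "p \<in> L"
proof -
  have "p * (\<Prod>i\<leftarrow>is. y i) \<in> L"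
    if "m \<le> k" "p \<in> Fc" "homog (int m * d) p" "length is = k - m" "set is \<subseteq> {..n}" for m p "is"
    using that
  proof (induction m arbitrary: p "is")
    case 0
    then show ?case using base by simp
  next
    case (Suc m)
    let ?w = "\<Prod>i\<leftarrow>is. y i"
    have "?w \<in> Fc"
      using Suc.prems y by (intro free_carrier_prod_list) auto
    then have "lin_closed {x. p * x * ?w \<in> L}"
      using Suc.prems by (intro lin_closed_sandwich L)
    \<comment> \<open>The inserted product is divided between its neighbours: \<open>u i\<close>
      joins \<open>p\<close> and brings its charge to \<open>int m * d\<close>, and
      \<open>y j\<close> becomes the first letter of the word split off.\<close>
    moreover have "u i * y j \<in> {x. p * x * ?w \<in> L}" if "i \<le> n" "j \<le> n" for i j
    proof -
      have "homog (int m * d) (p * u i)"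
        using homog_mult[OF Suc.prems(3) u(2)[of i]] by (simp add: algebra_simps)
      then have "(p * u i) * (\<Prod>i\<leftarrow>j # is. y i) \<in> L"
        using Suc.prems that u(1) by (intro Suc.IH) auto
      then show ?thesis
        by (simp add: mult.assoc)
    qed
    ultimately have "1 \<in> {x. p * x * ?w \<in> L}"
      by (rule unit)
    then show ?case
      by simp
  qed
  from this[of k p "[]"] p show ?thesis
    by simp
qed

section \<open>The entries of the generating vector\<close>

lemma finite_multi_indices: "finite (multi_indices n m)"
proof (rule finite_subset)
  show "multi_indices n m \<subseteq> {..n} \<rightarrow>\<^sub>E {..m}"
  proof
    fix j assume j: "j \<in> multi_indices n m"
    have "j a \<le> m" if "a \<le> n" for a
      using j member_le_sum[of a "{..n}" j] that by (auto simp: multi_indices_def)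
    then show "j \<in> {..n} \<rightarrow>\<^sub>E {..m}"
      using j by (auto simp: multi_indices_def PiE_def)
  qed
qed (auto intro: finite_PiE)

text \<open>For \<open>0 < q < 1\<close> numerator and denominator are both negative.\<close>

lemma q_int_pos: "m > 0 \<Longrightarrow> q_int q m > 0"
proof -
  assume "m > 0"
  then have "q ^ m < 1"
    using q_pos q_less_one by (simp add: power_less_one_iff)
  moreover have "1 < inverse q ^ m" "1 < inverse q"
    using \<open>m > 0\<close> q_pos q_less_one by (simp_all add: one_less_inverse one_less_power)
  ultimately have "q ^ m - inverse q ^ m < 0" "q - inverse q < 0"
    using q_less_one by linarith+
  then show "q_int q m > 0"
    unfolding q_int_def by (rule divide_neg_neg)
qed

text \<open>This makes the normalising scalar in \<open>psi\<close> invertible.\<close>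

lemma q_multinomial_pos: "q_multinomial n q j > 0"
proof -
  have "q_fact q m > 0" for m
    unfolding q_fact_def by (rule prod_pos) (auto intro: q_int_pos)
  then show ?thesis
    unfolding q_multinomial_def by (intro divide_pos_pos prod_pos) auto
qed

text \<open>The value \<open>N = 0\<close> is counted with the starred letters, as in
  \<open>psi\<close>.\<close>

definition psi_letter :: "int \<Rightarrow> nat \<Rightarrow> free_alg" where
  "psi_letter N = (if N \<ge> 0 then zf_star else zf)"

lemma psi_letter_carrier: "i \<le> n \<Longrightarrow> psi_letter N i \<in> Fc"
  by (auto simp: psi_letter_def)

lemma homog_psi_letter: "homog (if N \<ge> 0 then - 1 else 1) (psi_letter N i)"
  by (simp add: psi_letter_def)

text \<open>The involution is applied to each power separately, so the order of the indices is
  increasing for both signs of \<open>N\<close>.\<close>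

lemma psi_eq: "\<exists>c. c \<noteq> 0 \<and> psi n q N j = cls (scale c (ordered_monomial (psi_letter N) j))"
proof -
  have prod: "ordered_prod A n (\<lambda>a. star A (z n q a [^]\<^bsub>A\<^esub> j a)) = cls (ordered_monomial zf_star j)"
    "ordered_prod A n (\<lambda>a. z n q a [^]\<^bsub>A\<^esub> j a) = cls (ordered_monomial zf j)"
  proof -
    have "map (\<lambda>a. star A (z n q a [^]\<^bsub>A\<^esub> j a)) [0..<Suc n] =
        map (\<lambda>a. cls (zf_star a ^ j a)) [0..<Suc n]"
      by (rule map_cong)
        (auto simp: z_eq_cls sphere_pow sphere_star free_star_power free_carrier_zf)
    then have "ordered_prod A n (\<lambda>a. star A (z n q a [^]\<^bsub>A\<^esub> j a)) =
        ordered_prod A n (\<lambda>a. cls (zf_star a ^ j a))"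
      by (simp only: ordered_prod_def)
    then show "ordered_prod A n (\<lambda>a. star A (z n q a [^]\<^bsub>A\<^esub> j a)) = cls (ordered_monomial zf_star j)"
      unfolding ordered_monomial_def by (subst sphere_ordered_prod[symmetric]) auto
    have "map (\<lambda>a. z n q a [^]\<^bsub>A\<^esub> j a) [0..<Suc n] = map (\<lambda>a. cls (zf a ^ j a)) [0..<Suc n]"
      by (rule map_cong) (auto simp: z_eq_cls sphere_pow free_carrier_zf)
    then have "ordered_prod A n (\<lambda>a. z n q a [^]\<^bsub>A\<^esub> j a) = ordered_prod A n (\<lambda>a. cls (zf a ^ j a))"
      by (simp only: ordered_prod_def)
    then show "ordered_prod A n (\<lambda>a. z n q a [^]\<^bsub>A\<^esub> j a) = cls (ordered_monomial zf j)"
      unfolding ordered_monomial_def by (subst sphere_ordered_prod[symmetric]) auto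
  qed
  have nz: "complex_of_real (sqrt (q_multinomial n q j) * q powr e) \<noteq> 0" for e
    using q_multinomial_pos[of j] q_pos by simp
  show ?thesis
  proof (cases "N \<ge> 0")
    case True
    then show ?thesis
      unfolding psi_def Let_def prod psi_letter_def sphere_smult using nz by (simp only: if_True) blast
  next
    case False
    then show ?thesis
      unfolding psi_def Let_def prod psi_letter_def sphere_smult using nz by (simp only: if_False) blast
  qed
qed

text \<open>The coefficients from \<open>cp n q\<close> lift to free elements of charge zero, and
  these absorb the nonzero scalars of \<open>psi\<close>.\<close>

lemma line_bundle_eq_combinations:
  defines "J \<equiv> \<lambda>N. multi_indices n (nat \<bar>N\<bar>)"
  shows "line_bundle n q N = {cls (\<Sum>j\<in>J N. a j * ordered_monomial (psi_letter N) j) | a.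
    \<forall>j\<in>J N. a j \<in> Fc \<and> homog 0 (a j)}" (is "_ = ?R")
proof -
  interpret ring A by (rule ring_sphere)
  obtain c where c: "c j \<noteq> 0" "psi n q N j = cls (scale (c j) (ordered_monomial (psi_letter N) j))" for j
    using psi_eq[of N] by metis
  have mono: "ordered_monomial (psi_letter N) j \<in> Fc" for j
    by (intro ordered_monomial_carrier psi_letter_carrier)
  have finsum: "finsum A (\<lambda>j. v j \<otimes>\<^bsub>A\<^esub> psi n q N j) (J N) =
      cls (\<Sum>j\<in>J N. scale (c j) (a j) * ordered_monomial (psi_letter N) j)"
    if "\<And>j. j \<in> J N \<Longrightarrow> a j \<in> Fc \<and> v j = cls (a j)" for v a
  proof -
    have a: "a j \<in> Fc" and v: "v j = cls (a j)" if "j \<in> J N" for j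
      using \<open>\<And>j. j \<in> J N \<Longrightarrow> a j \<in> Fc \<and> v j = cls (a j)\<close> that by auto
    have "finsum A (\<lambda>j. v j \<otimes>\<^bsub>A\<^esub> psi n q N j) (J N) =
        finsum A (\<lambda>j. cls (scale (c j) (a j) * ordered_monomial (psi_letter N) j)) (J N)"
      using a mono
      by (intro finsum_cong') (auto simp: v c(2) sphere_mult free_carrier_scale scale_mult_left
          scale_mult_right intro!: cls_closed)
    also have "\<dots> = cls (\<Sum>j\<in>J N. scale (c j) (a j) * ordered_monomial (psi_letter N) j)"
      using a mono by (intro sphere_finsum) (auto simp: finite_multi_indices J_def)
    finally show ?thesis .
  qed
  show ?thesis
  proof (intro subset_antisym subsetI)
    fix x assume "x \<in> line_bundle n q N"
    then obtain v where v: "\<forall>j\<in>J N. v j \<in> cp n q"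
      and x: "x = finsum A (\<lambda>j. v j \<otimes>\<^bsub>A\<^esub> psi n q N j) (J N)"
      unfolding line_bundle_def Let_def J_def by blast
    then have "\<forall>j\<in>J N. \<exists>a. a \<in> Fc \<and> homog 0 a \<and> v j = cls a"
      unfolding cp_eq by blast
    then obtain a where a: "\<forall>j\<in>J N. a j \<in> Fc \<and> homog 0 (a j) \<and> v j = cls (a j)"
      by metis
    then show "x \<in> ?R"
      using x finsum[of a v] by (auto intro!: exI[of _ "\<lambda>j. scale (c j) (a j)"] homog_scale)
  next
    fix x assume "x \<in> ?R"
    then obtain a where a: "\<forall>j\<in>J N. a j \<in> Fc \<and> homog 0 (a j)"
      and x: "x = cls (\<Sum>j\<in>J N. a j * ordered_monomial (psi_letter N) j)"
      by blast
    \<comment> \<open>Dividing by \<open>c j\<close> compensates the scalar in the entry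
      \<open>psi n q N j\<close>.\<close>
    let ?a = "\<lambda>j. scale (inverse (c j)) (a j)"
    have *: "x = finsum A (\<lambda>j. cls (?a j) \<otimes>\<^bsub>A\<^esub> psi n q N j) (J N)"
      using a c(1) by (subst finsum[of ?a]) (auto simp: x)
    have **: "\<forall>j\<in>J N. cls (?a j) \<in> cp n q"
      using a unfolding cp_eq by (auto intro: homog_scale)
    show "x \<in> line_bundle n q N"
      unfolding line_bundle_def Let_def
      by (intro CollectI exI[of _ "\<lambda>j. cls (?a j)"] conjI *[unfolded J_def] **[unfolded J_def])
  qed
qed

lemma homog_ordered_monomial:
  assumes "j \<in> multi_indices n (nat \<bar>N\<bar>)"
  shows "homog (- N) (ordered_monomial (psi_letter N) j)"
proof -
  let ?d = "if N \<ge> 0 then - 1 else 1 :: int"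
  have "homog (\<Sum>a\<leftarrow>[0..<Suc n]. int (j a) * ?d) (ordered_monomial (psi_letter N) j)"
    unfolding ordered_monomial_def by (intro homog_prod_list homog_power homog_psi_letter)
  also have "(\<Sum>a\<leftarrow>[0..<Suc n]. int (j a) * ?d) = (\<Sum>a\<le>n. int (j a)) * ?d"
    by (simp only: interv_sum_list_conv_sum_set_nat sum_distrib_right set_upt
        atLeast0LessThan lessThan_Suc_atMost)
  also have "(\<Sum>a\<le>n. int (j a)) = \<bar>N\<bar>"
    using assms by (auto simp: multi_indices_def simp flip: of_nat_sum)
  also have "\<bar>N\<bar> * ?d = - N"
    by simp
  finally show ?thesis .
qed

lemma line_bundle_eq: "line_bundle n q N = cls ` {p \<in> Fc. homog (- N) p}"
proof
  have "ordered_monomial (psi_letter N) j \<in> Fc" for j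
    by (intro ordered_monomial_carrier psi_letter_carrier)
  moreover have "homog (- N) (a * ordered_monomial (psi_letter N) j)"
    if "homog 0 a" "j \<in> multi_indices n (nat \<bar>N\<bar>)" for a j
    using homog_mult[OF that(1) homog_ordered_monomial[OF that(2)]] by simp
  ultimately show "line_bundle n q N \<subseteq> cls ` {p \<in> Fc. homog (- N) p}"
    unfolding line_bundle_eq_combinations
    by (auto intro!: imageI homog_sum free_carrier_sum)
next
  let ?J = "multi_indices n (nat \<bar>N\<bar>)"
  \<comment> \<open>\<open>?u\<close> gives the letters of the other kind:
    \<open>psi_letter (- 1)\<close> is \<open>zf\<close> and \<open>psi_letter 0\<close> is
    \<open>zf_star\<close>. Hence the products \<open>?u i * ?y j\<close> have charge zero.\<close>
  let ?y = "psi_letter N" and ?u = "psi_letter (if N \<ge> 0 then - 1 else 0)"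
  let ?d = "if N \<ge> 0 then - 1 else 1 :: int"
  let ?s = "\<lambda>a. \<Sum>j\<in>?J. a j * ordered_monomial ?y j"
  \<comment> \<open>Representatives, modulo the ideal, of the combinations that make up the
    bundle.\<close>
  define L where "L = {p. \<exists>a. (\<forall>j\<in>?J. a j \<in> Fc \<and> homog 0 (a j)) \<and> p - ?s a \<in> I}"
  have L: "lin_closed L"
    unfolding lin_closed_def
  proof (intro conjI ballI allI subsetI)
    fix p assume "p \<in> I"
    then show "p \<in> L"
      unfolding L_def by (auto intro!: exI[of _ "\<lambda>_. 0"])
  next
    fix p p' assume "p \<in> L" "p' \<in> L"
    then obtain a a' where a: "\<forall>j\<in>?J. a j \<in> Fc \<and> homog 0 (a j)" "p - ?s a \<in> I"
      and a': "\<forall>j\<in>?J. a' j \<in> Fc \<and> homog 0 (a' j)" "p' - ?s a' \<in> I"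
      unfolding L_def by blast
    have "p + p' - ?s (\<lambda>j. a j + a' j) = (p - ?s a) + (p' - ?s a')"
      by (simp add: distrib_right sum.distrib)
    also have "\<dots> \<in> I"
      using a a' by (intro sphere_ideal_add) auto
    finally show "p + p' \<in> L"
      unfolding L_def using a a' by (auto intro!: exI[of _ "\<lambda>j. a j + a' j"] homog_add)
  next
    fix c p assume "p \<in> L"
    then obtain a where a: "\<forall>j\<in>?J. a j \<in> Fc \<and> homog 0 (a j)" "p - ?s a \<in> I"
      unfolding L_def by blast
    have "scale c p - ?s (\<lambda>j. scale c (a j)) = scale c (p - ?s a)"
      by (simp add: scale_diff_right scale_sum scale_mult_left)
    also have "\<dots> \<in> I"
      using a by (intro sphere_ideal_scale) auto
    finally show "scale c p \<in> L"
      unfolding L_def using a by (auto intro!: exI[of _ "\<lambda>j. scale c (a j)"] homog_scale)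
  qed
  have "p \<in> L" if p: "p \<in> Fc" "homog (- N) p" for p
  proof (rule lin_closed_factor[OF L, where y = ?y and u = ?u and d = ?d])
    show "homog (- ?d) (?u i)" for i
      by (simp add: psi_letter_def)
    \<comment> \<open>For \<open>N \<ge> 0\<close> the products are \<open>zf i * zf_star j\<close>,
      and the sphere relation applies at once. For \<open>N < 0\<close> they are
      \<open>zf_star i * zf j\<close> and have to be exchanged before.\<close>
    show "1 \<in> L'" if "lin_closed L'" "\<And>i j. i \<le> n \<Longrightarrow> j \<le> n \<Longrightarrow> ?u i * ?y j \<in> L'" for L'
    proof (cases "N \<ge> 0")
      case True
      then show ?thesis
        using that by (intro lin_closed_unit) (auto simp: psi_letter_def)
    next
      case False
      then show ?thesis
        using that lin_closed_swap_zs[OF that(1)]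
        by (intro lin_closed_unit) (auto simp: psi_letter_def)
    qed
    have comm: "qcomm (?y i) (?y j)" if "i \<le> n" "j \<le> n" for i j
      using that qcomm_zf qcomm_zf_star by (simp add: psi_letter_def)
    show "a * (\<Prod>i\<leftarrow>is. ?y i) \<in> L"
      if a: "a \<in> Fc" "homog 0 a" and "is": "length is = nat \<bar>N\<bar>" "set is \<subseteq> {..n}" for a "is"
    proof -
      have "\<exists>c. \<exists>j\<in>multi_indices n (length is).
          (\<Prod>i\<leftarrow>is. ?y i) - scale c (ordered_monomial ?y j) \<in> I"
        by (rule ordered_monomial_eq_prod_list) (use psi_letter_carrier comm "is"(2) in auto)
      then obtain c j where j: "j \<in> ?J"
        and c: "(\<Prod>i\<leftarrow>is. ?y i) - scale c (ordered_monomial ?y j) \<in> I"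
        using "is"(1) by auto
      \<comment> \<open>A single multi-index carries the whole coefficient, which takes up the
        scalar from the reordering.\<close>
      let ?a = "\<lambda>j'. if j' = j then scale c a else 0"
      have "?s ?a = (\<Sum>j'\<in>?J. if j' = j then scale c a * ordered_monomial ?y j else 0)"
        by (rule sum.cong) auto
      also have "\<dots> = scale c a * ordered_monomial ?y j"
        using j by (simp add: finite_multi_indices)
      finally have "a * (\<Prod>i\<leftarrow>is. ?y i) - ?s ?a =
          a * ((\<Prod>i\<leftarrow>is. ?y i) - scale c (ordered_monomial ?y j))"
        by (simp add: right_diff_distrib scale_mult_left scale_mult_right)
      also have "\<dots> \<in> I"
        using a c by (intro sphere_ideal_mult_left)
      finally show ?thesis
        unfolding L_def using a by (auto intro!: exI[of _ ?a] homog_scale)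
    qed
    show "homog (int (nat \<bar>N\<bar>) * ?d) p"
      using p by simp
  qed (use p in \<open>auto intro: psi_letter_carrier\<close>)
  then show "cls ` {p \<in> Fc. homog (- N) p} \<subseteq> line_bundle n q N"
    unfolding line_bundle_eq_combinations L_def by (fastforce simp: cls_eq_iff)
qed

end

section \<open>Rotations of the quantum sphere\<close>

context quantum_sphere
begin

text \<open>Restricted to the carrier, because the elements of \<open>Bij\<close> are
  extensional.\<close>

definition sphere_rotate :: "complex \<Rightarrow> free_alg set \<Rightarrow> free_alg set" where
  "sphere_rotate t = (\<lambda>C\<in>carrier A. coset_map (free_star_algebra n) I (rotate_free t) C)"

lemma sphere_rotate_cls: "p \<in> Fc \<Longrightarrow> sphere_rotate t (cls p) = cls (rotate_free t p)"
  by (simp add: sphere_rotate_def cls_closed coset_map_cls rotate_free_eq charge_mult_diff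
      sphere_ideal_charge_mult)

lemma sphere_rotate_closed: "x \<in> carrier A \<Longrightarrow> sphere_rotate t x \<in> carrier A"
  by (auto simp: sphere_carrier sphere_rotate_cls rotate_free_eq)

lemma sphere_rotate_one: "x \<in> carrier A \<Longrightarrow> sphere_rotate 1 x = x"
proof -
  have "rotate_free 1 p = p" for p
    by (rule poly_mapping_eqI) (simp add: rotate_free_eq lookup_charge_mult)
  then show "x \<in> carrier A \<Longrightarrow> sphere_rotate 1 x = x"
    by (auto simp: sphere_carrier sphere_rotate_cls)
qed

lemma sphere_rotate_rotate: "x \<in> carrier A \<Longrightarrow> sphere_rotate t (sphere_rotate u x) = sphere_rotate (t * u) x"
  by (auto simp: sphere_carrier sphere_rotate_cls rotate_free_eq charge_mult_charge_mult
      free_carrier_charge_mult power_int_mult_distrib)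

lemma sphere_rotate_unit: "sphere_rotate t \<one>\<^bsub>A\<^esub> = \<one>\<^bsub>A\<^esub>"
  by (simp add: sphere_one sphere_rotate_cls rotate_free_eq homog_charge_mult[OF homog_one])

lemma sphere_rotate_add:
  "x \<in> carrier A \<Longrightarrow> y \<in> carrier A \<Longrightarrow> sphere_rotate t (x \<oplus>\<^bsub>A\<^esub> y) = sphere_rotate t x \<oplus>\<^bsub>A\<^esub> sphere_rotate t y"
  by (auto simp: sphere_carrier sphere_add sphere_rotate_cls rotate_free_eq charge_mult_add
      free_carrier_add free_carrier_charge_mult)

text \<open>The condition \<open>t \<noteq> 0\<close> makes \<open>\<lambda>d. t powi d\<close> a
  character of the integers, negative exponents included.\<close>

lemma sphere_rotate_mult:
  assumes "t \<noteq> 0" "x \<in> carrier A" "y \<in> carrier A"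
  shows "sphere_rotate t (x \<otimes>\<^bsub>A\<^esub> y) = sphere_rotate t x \<otimes>\<^bsub>A\<^esub> sphere_rotate t y"
  using assms by (auto simp: sphere_carrier sphere_mult sphere_rotate_cls rotate_free_eq charge_mult_mult
      free_carrier_mult free_carrier_charge_mult power_int_add)

lemma sphere_rotate_smult: "x \<in> carrier A \<Longrightarrow> sphere_rotate t (c \<odot>\<^bsub>A\<^esub> x) = c \<odot>\<^bsub>A\<^esub> sphere_rotate t x"
  by (auto simp: sphere_carrier sphere_smult sphere_rotate_cls rotate_free_eq charge_mult_scale
      free_carrier_scale)

text \<open>The involution negates the charge and conjugates the factor \<open>t powi d\<close>; for
  \<open>t\<close> of modulus one the two effects cancel.\<close>

lemma sphere_rotate_star:
  assumes "norm t = 1" "x \<in> carrier A"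
  shows "sphere_rotate t (star A x) = star A (sphere_rotate t x)"
proof -
  have "cnj t = inverse t"
    using assms(1) by (simp add: inverse_complex_def complex_cnj cmod_def complex_eq_iff)
  then have "cnj (t powi (- d)) = t powi d" for d
    by (simp add: complex_cnj_power_int power_int_minus power_int_inverse)
  then show ?thesis
    using assms(2) by (auto simp: sphere_carrier sphere_star sphere_rotate_cls rotate_free_eq
        charge_mult_free_star free_carrier_star)
qed

lemma sphere_rotate_in_star_auto:
  assumes "norm t = 1"
  shows "sphere_rotate t \<in> star_auto A"
proof -
  have t: "t \<noteq> 0"
    using assms by auto
  have "bij_betw (sphere_rotate t) (carrier A) (carrier A)"
    by (rule bij_betw_byWitness[where f' = "sphere_rotate (inverse t)"])
      (auto simp: sphere_rotate_rotate sphere_rotate_one sphere_rotate_closed t)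
  then have "sphere_rotate t \<in> Bij (carrier A)"
    by (simp add: Bij_def sphere_rotate_def)
  moreover have "sphere_rotate t \<in> ring_hom A A"
    by (rule ring_hom_memI) (auto simp: sphere_rotate_closed sphere_rotate_mult sphere_rotate_add sphere_rotate_unit t)
  ultimately show ?thesis
    by (simp add: star_auto_def sphere_rotate_smult sphere_rotate_star assms)
qed

lemma sphere_rotate_mult_BijGroup:
  assumes "norm t = 1" "norm u = 1"
  shows "sphere_rotate t \<otimes>\<^bsub>star_AutoGroup A\<^esub> sphere_rotate u = sphere_rotate (t * u)"
proof -
  have "sphere_rotate t \<in> Bij (carrier A)" "sphere_rotate u \<in> Bij (carrier A)"
    using assms sphere_rotate_in_star_auto by (auto simp: star_auto_def)
  then have "sphere_rotate t \<otimes>\<^bsub>star_AutoGroup A\<^esub> sphere_rotate u = compose (carrier A) (sphere_rotate t) (sphere_rotate u)"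
    by (simp add: star_AutoGroup_def BijGroup_def)
  \<comment> \<open>Outside the carrier both sides are undefined, so they agree as
    functions.\<close>
  also have "\<dots> = sphere_rotate (t * u)"
  proof
    fix x
    show "compose (carrier A) (sphere_rotate t) (sphere_rotate u) x = sphere_rotate (t * u) x"
      by (cases "x \<in> carrier A") (simp_all add: compose_def sphere_rotate_rotate,
          simp add: sphere_rotate_def)
  qed
  finally show ?thesis .
qed

lemma star_subalgebra_fixed_points:
  assumes "\<And>t. t \<in> T \<Longrightarrow> norm t = 1"
  shows "star_subalgebra {x \<in> carrier A. \<forall>t\<in>T. sphere_rotate t x = x} A"
proof -
  interpret ring A by (rule ring_sphere)
  have "t \<noteq> 0" if "t \<in> T" for t
    using assms[OF that] by auto
  moreover have "c \<odot>\<^bsub>A\<^esub> x \<in> carrier A" "star A x \<in> carrier A" if "x \<in> carrier A" for c x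
    using that by (auto simp: sphere_carrier sphere_smult sphere_star)
  ultimately show ?thesis
    by (intro star_subalgebraI complex_star_algebra_sphere)
      (auto simp: sphere_rotate_unit sphere_rotate_add sphere_rotate_mult sphere_rotate_smult sphere_rotate_star assms)
qed

text \<open>If the sum vanishes, the sum of homogeneous representatives lies in the ideal. Its
  projection to charge \<open>- h i\<close> is again in the ideal and, \<open>h\<close> being
  injective, is the representative of index \<open>i\<close>.\<close>

lemma direct_family_line_bundle:
  fixes h :: "'i \<Rightarrow> int"
  assumes "inj h"
  shows "direct_family A (\<lambda>i. line_bundle n q (h i))"
  unfolding direct_family_def
proof (intro conjI allI impI ballI)
  interpret ring A by (rule ring_sphere)
  fix i
  show "submodule (line_bundle n q (h i)) complex_ring A"
  proof (rule module.submoduleI)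
    show "module complex_ring A"
      using complex_star_algebra_sphere by (rule complex_star_algebra.axioms)
  next
    fix x assume "x \<in> line_bundle n q (h i)"
    then obtain p where p: "p \<in> Fc" "homog (- h i) p" "x = cls p"
      by (auto simp: line_bundle_eq)
    have "\<ominus>\<^bsub>A\<^esub> x = cls (- p)"
      using p(1,3) free_carrier_uminus[of p n]
      by (intro minus_equality) (auto simp: sphere_add sphere_zero)
    then show "\<ominus>\<^bsub>A\<^esub> x \<in> line_bundle n q (h i)"
      using p homog_diff[of "- h i" 0 p] by (auto simp: line_bundle_eq)
  qed (auto simp: line_bundle_eq sphere_zero sphere_add sphere_smult homog_add homog_scale)
next
  interpret ring A by (rule ring_sphere)
  fix F x i
  assume F: "finite F" "\<forall>i\<in>F. x i \<in> line_bundle n q (h i)" "finsum A x F = \<zero>\<^bsub>A\<^esub>" and i: "i \<in> F"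
  from F(2) have "\<forall>i\<in>F. \<exists>p. p \<in> Fc \<and> homog (- h i) p \<and> x i = cls p"
    by (auto simp: line_bundle_eq)
  then obtain p where p: "\<forall>i\<in>F. p i \<in> Fc \<and> homog (- h i) (p i) \<and> x i = cls (p i)"
    by metis
  have "finsum A x F = finsum A (\<lambda>i. cls (p i)) F"
    using p by (intro finsum_cong') auto
  also have "\<dots> = cls (\<Sum>i\<in>F. p i)"
    using p F(1) by (intro sphere_finsum) auto
  finally have "(\<Sum>i\<in>F. p i) \<in> I"
    using F(3) cls_eq_iff[of "\<Sum>i\<in>F. p i" 0] by (simp add: sphere_zero)
  then have "charge_mult (\<lambda>e. if e = - h i then 1 else 0) (\<Sum>i\<in>F. p i) \<in> I"
    by (rule sphere_ideal_charge_mult)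
  also have "charge_mult (\<lambda>e. if e = - h i then 1 else 0) (\<Sum>i\<in>F. p i) =
      (\<Sum>j\<in>F. scale (if - h j = - h i then 1 else 0) (p j))"
    unfolding charge_mult_sum using p by (intro sum.cong homog_charge_mult) auto
  also have "\<dots> = (\<Sum>j\<in>F. if j = i then p j else 0)"
    using injD[OF assms] by (intro sum.cong) auto
  also have "\<dots> = p i"
    using F(1) i by simp
  finally show "x i = \<zero>\<^bsub>A\<^esub>"
    using p i by (simp add: sphere_zero cls_eq_iff)
qed

end

section \<open>The lens space\<close>

definition root_of_unity :: "nat \<Rightarrow> int \<Rightarrow> complex" where
  "root_of_unity r k = exp (2 * of_real pi * \<i> * of_int k / of_nat r)"

lemma root_of_unity_eq_cis: "root_of_unity r k = cis (2 * pi * of_int k / of_nat r)"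
  by (simp add: root_of_unity_def cis_conv_exp mult_ac)

lemma norm_root_of_unity [simp]: "norm (root_of_unity r k) = 1"
  by (simp add: root_of_unity_eq_cis)

lemma root_of_unity_add: "root_of_unity r (k + l) = root_of_unity r k * root_of_unity r l"
  by (simp add: root_of_unity_eq_cis cis_mult add_divide_distrib distrib_left)

lemma root_of_unity_powi: "root_of_unity r k powi d = root_of_unity r (k * d)"
  by (simp add: root_of_unity_eq_cis cis_power_int mult_ac)

lemma root_of_unity_eq_one_iff:
  assumes "r > 0"
  shows "root_of_unity r k = 1 \<longleftrightarrow> int r dvd k"
proof
  assume "root_of_unity r k = 1"
  \<comment> \<open>The real part suffices: the cosine is \<open>1\<close> only at integer multiples
    of \<open>2 * pi\<close>.\<close>
  then have "cos (2 * pi * of_int k / of_nat r) = 1"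
    by (simp add: root_of_unity_eq_cis complex_eq_iff)
  then obtain m :: int where "2 * pi * of_int k / of_nat r = of_int m * 2 * pi"
    using cos_one_2pi_int by blast
  then have "of_int k = (of_int m * of_nat r :: real)"
    using assms by (simp add: field_simps)
  then have "k = m * int r"
    by (metis of_int_eq_iff of_int_mult of_int_of_nat_eq)
  then show "int r dvd k"
    by simp
next
  assume "int r dvd k"
  then obtain m where "k = int r * m" ..
  then have "2 * pi * of_int k / of_nat r = 2 * pi * of_int m"
    using assms by simp
  then show "root_of_unity r k = 1"
    by (simp add: root_of_unity_eq_cis cis_multiple_2pi)
qed

text \<open>Addition in \<open>integer_mod_group r\<close> reduces modulo \<open>r\<close>; this
  reconciles it with multiplication of the roots.\<close>

lemma root_of_unity_mod: "r > 0 \<Longrightarrow> root_of_unity r (k mod int r) = root_of_unity r k"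
  using root_of_unity_add[of r "k mod int r" "int r * (k div int r)"]
    root_of_unity_eq_one_iff[of r "int r * (k div int r)"] by simp

context quantum_sphere
begin

lemma cyclic_action_eq: "cyclic_action n r q k = sphere_rotate (root_of_unity r k)"
  by (simp add: cyclic_action_def sphere_rotate_def root_of_unity_def)

lemma cyclic_action_hom:
  assumes "r > 0"
  shows "cyclic_action n r q \<in> hom (integer_mod_group r) (star_AutoGroup A)"
proof (rule homI)
  fix k l
  show "cyclic_action n r q k \<in> carrier (star_AutoGroup A)"
    by (simp add: cyclic_action_eq star_AutoGroup_def sphere_rotate_in_star_auto)
  show "cyclic_action n r q (k \<otimes>\<^bsub>integer_mod_group r\<^esub> l) =
      cyclic_action n r q k \<otimes>\<^bsub>star_AutoGroup A\<^esub> cyclic_action n r q l"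
    using assms by (simp add: cyclic_action_eq sphere_rotate_mult_BijGroup root_of_unity_mod root_of_unity_add)
qed

lemma cyclic_action_z:
  assumes "i \<le> n"
  shows "cyclic_action n r q k (z n q i) = root_of_unity r k \<odot>\<^bsub>A\<^esub> z n q i"
  using assms homog_charge_mult[OF homog_zf]
  by (simp add: cyclic_action_eq z_eq_cls sphere_rotate_cls free_carrier_zf rotate_free_eq sphere_smult)

lemma lens_subset_fixed_points:
  assumes "r > 0" "x \<in> lens n r q"
  shows "x \<in> carrier A" "cyclic_action n r q k x = x"
proof -
  interpret ring A by (rule ring_sphere)
  obtain v F where F: "finite F" "\<forall>i\<in>F. v i \<in> line_bundle n q (int r * i)" "x = finsum A v F"
    using assms by (auto simp: lens_def family_sum_def)
  then have "\<forall>i\<in>F. \<exists>p. p \<in> Fc \<and> homog (- (int r * i)) p \<and> v i = cls p"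
    by (auto simp: line_bundle_eq)
  then obtain p where p: "\<forall>i\<in>F. p i \<in> Fc \<and> homog (- (int r * i)) (p i) \<and> v i = cls (p i)"
    by metis
  have "x = finsum A (\<lambda>i. cls (p i)) F"
    unfolding F(3) using p by (intro finsum_cong') auto
  also have "\<dots> = cls (\<Sum>i\<in>F. p i)"
    using p F(1) by (intro sphere_finsum) auto
  finally have x: "x = cls (\<Sum>i\<in>F. p i)" .
  have sum: "(\<Sum>i\<in>F. p i) \<in> Fc"
    using p by auto
  then show "x \<in> carrier A"
    unfolding x by auto
  have "rotate_free (root_of_unity r k) (\<Sum>i\<in>F. p i) = (\<Sum>i\<in>F. p i)"
    unfolding rotate_free_eq charge_mult_sum
  proof (rule sum.cong)
    fix i assume "i \<in> F"
    \<comment> \<open>The exponent is a multiple of \<open>r\<close>, so the rotation fixes each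
      summand.\<close>
    moreover have "root_of_unity r k powi - (int r * i) = 1"
      using assms(1) by (simp only: root_of_unity_powi root_of_unity_eq_one_iff) simp
    ultimately show "charge_mult ((powi) (root_of_unity r k)) (p i) = p i"
      using p by (simp add: homog_charge_mult[of "- (int r * i)"])
  qed simp
  then show "cyclic_action n r q k x = x"
    unfolding cyclic_action_eq x by (simp add: sphere_rotate_cls sum)
qed

text \<open>Invariance under the generator kills the components whose charge is not divisible by
  \<open>r\<close>: for those the factor \<open>\<zeta>\<^sup>d - 1\<close> can be divided out inside the ideal.\<close>

lemma fixed_points_subset_lens:
  assumes r: "r > 0" and x: "x \<in> carrier A" and fixed: "cyclic_action n r q 1 x = x"
  shows "x \<in> lens n r q"
proof -
  interpret ring A by (rule ring_sphere)
  let ?t = "root_of_unity r 1"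
  obtain p where p: "p \<in> Fc" "x = cls p"
    using x by (auto simp: sphere_carrier)
  \<comment> \<open>Where \<open>r\<close> divides the charge, the rotation minus the identity
    vanishes and the value \<open>0\<close> is chosen; the composite is the projection onto the
    remaining charges.\<close>
  have "charge_mult (\<lambda>d. if int r dvd d then 0 else inverse (?t powi d - 1))
      (rotate_free ?t p - p) \<in> I"
    using fixed p by (intro sphere_ideal_charge_mult) (simp add: cyclic_action_eq sphere_rotate_cls cls_eq_iff)
  also have "charge_mult (\<lambda>d. if int r dvd d then 0 else inverse (?t powi d - 1)) (rotate_free ?t p - p) =
      charge_mult (\<lambda>d. if int r dvd d then 0 else 1) p"
  proof (rule poly_mapping_eqI)
    fix w
    have "?t powi charge w \<noteq> 1" if "\<not> int r dvd charge w"
      using that r by (simp add: root_of_unity_powi root_of_unity_eq_one_iff)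
    then show "Poly_Mapping.lookup (charge_mult (\<lambda>d. if int r dvd d then 0 else inverse (?t powi d - 1))
          (rotate_free ?t p - p)) w =
        Poly_Mapping.lookup (charge_mult (\<lambda>d. if int r dvd d then 0 else 1) p) w"
      by (auto simp: lookup_charge_mult lookup_minus rotate_free_eq field_simps)
  qed
  finally have I: "charge_mult (\<lambda>d. if int r dvd d then 0 else 1) p \<in> I" .
  \<comment> \<open>A charge \<open>int r * m\<close> belongs to the index \<open>- m\<close>. Words
    of other charges may add indices through rounding; \<open>v N\<close> is still the full
    component of charge \<open>- (int r * N)\<close>, possibly zero, so no term is wrong or counted
    twice.\<close>
  define F where "F = (\<lambda>w. - (charge w div int r)) ` Poly_Mapping.keys p"
  define v where "v N = charge_mult (\<lambda>d. if d = - (int r * N) then 1 else 0) p" for N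
  have v: "v N \<in> Fc" for N
    unfolding v_def using p by auto
  have "p - charge_mult (\<lambda>d. if int r dvd d then 0 else 1) p = (\<Sum>N\<in>F. v N)"
  proof (rule poly_mapping_eqI)
    fix w
    have "(\<Sum>N\<in>F. (if charge w = - (int r * N) then 1 else 0) * Poly_Mapping.lookup p w) =
        (if int r dvd charge w then Poly_Mapping.lookup p w else 0)"
    proof (cases "int r dvd charge w \<and> w \<in> Poly_Mapping.keys p")
      case True
      then obtain m where "charge w = int r * m"
        by blast
      then have "charge w = - (int r * N) \<longleftrightarrow> N = - (charge w div int r)" for N
        using r by (simp flip: mult_minus_right) auto
      moreover have "- (charge w div int r) \<in> F"
        using True by (auto simp: F_def)
      ultimately show ?thesis
        using True by (simp add: F_def sum.delta if_distrib[of "\<lambda>c. c * _"] cong: if_cong)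
    next
      case False
      then show ?thesis
        by (auto simp: in_keys_iff intro!: sum.neutral)
    qed
    then show "Poly_Mapping.lookup (p - charge_mult (\<lambda>d. if int r dvd d then 0 else 1) p) w =
        Poly_Mapping.lookup (\<Sum>N\<in>F. v N) w"
      by (simp add: v_def lookup_minus lookup_sum lookup_charge_mult)
  qed
  then have "p - (\<Sum>N\<in>F. v N) = charge_mult (\<lambda>d. if int r dvd d then 0 else 1) p"
    by (simp add: algebra_simps)
  then have "p - (\<Sum>N\<in>F. v N) \<in> I"
    using I by simp
  then have "x = cls (\<Sum>N\<in>F. v N)"
    using p by (simp add: cls_eq_iff)
  also have "\<dots> = finsum A (\<lambda>N. cls (v N)) F"
    using v by (intro sphere_finsum[symmetric]) (auto simp: F_def)
  finally have "x = finsum A (\<lambda>N. cls (v N)) F" .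
  moreover have "cls (v N) \<in> line_bundle n q (int r * N)" for N
    using v homog_indicator unfolding line_bundle_eq v_def by blast
  moreover have "finite F"
    by (simp add: F_def)
  ultimately show ?thesis
    unfolding lens_def family_sum_def by blast
qed

lemma lens_eq_fixed_points:
  assumes "r \<ge> 2"
  shows "lens n r q = {x \<in> carrier A. \<forall>k\<in>carrier (integer_mod_group r). cyclic_action n r q k x = x}"
proof (intro subset_antisym subsetI)
  fix x assume "x \<in> {x \<in> carrier A. \<forall>k\<in>carrier (integer_mod_group r). cyclic_action n r q k x = x}"
  \<comment> \<open>As \<open>r \<ge> 2\<close>, the generator \<open>1\<close> is one of the
    residues below \<open>r\<close>; invariance under it already forces membership in
    \<open>lens n r q\<close>.\<close>
  moreover have "1 \<in> carrier (integer_mod_group r)"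
    using assms by simp
  ultimately show "x \<in> lens n r q"
    using assms by (intro fixed_points_subset_lens) auto
qed (use assms in \<open>simp add: lens_subset_fixed_points[of r]\<close>)

lemma star_subalgebra_lens:
  assumes "r \<ge> 2"
  shows "star_subalgebra (lens n r q) A"
proof -
  have "lens n r q = {x \<in> carrier A. \<forall>t\<in>root_of_unity r ` carrier (integer_mod_group r).
      sphere_rotate t x = x}"
    unfolding lens_eq_fixed_points[OF assms] cyclic_action_eq by simp
  then show ?thesis
    by (simp only:) (rule star_subalgebra_fixed_points, auto)
qed

end

theorem proposition4p1:
  fixes n r :: nat and q :: real
  assumes "n \<ge> 1" and "r \<ge> 2" and "0 < q" and "q < 1"
  shows "direct_family (sphere n q) (\<lambda>N::int. line_bundle n q (int r * N))
    \<and> star_subalgebra (lens n r q) (sphere n q)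
    \<and> cyclic_action n r q \<in> hom (integer_mod_group r) (star_AutoGroup (sphere n q))
    \<and> (\<forall>i\<le>n. cyclic_action n r q 1 (z n q i)
           = exp (2 * of_real pi * \<i> / of_nat r) \<odot>\<^bsub>sphere n q\<^esub> z n q i)
    \<and> lens n r q = {x \<in> carrier (sphere n q).
         \<forall>k\<in>carrier (integer_mod_group r). cyclic_action n r q k x = x}"
proof -
  interpret quantum_sphere n q
    using assms by unfold_locales
  \<comment> \<open>Distinct \<open>N\<close> select distinct charges, which gives
    directness.\<close>
  have "inj (\<lambda>N. int r * N)"
    using assms by (auto intro: injI)
  moreover have "root_of_unity r 1 = exp (2 * of_real pi * \<i> / of_nat r)"
    by (simp add: root_of_unity_def)
  ultimately show ?thesis
    using direct_family_line_bundle[of "\<lambda>N. int r * N"] star_subalgebra_lens[OF \<open>r \<ge> 2\<close>] cyclic_action_hom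
      cyclic_action_z[of _ r 1] lens_eq_fixed_points[OF \<open>r \<ge> 2\<close>] \<open>r \<ge> 2\<close> by simp
qed

end
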